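(* Let $L>0$ and assume $T=L$ (a single time slice, $n=1$). Let $\Sigma_H$ be a (possibly non-uniform, adaptive) mesh of $\Sigma$, and let $\Sigma_h$ be the fine mesh obtained by decomposing each element $\tau_\ell^H$ of $\Sigma_H$ into $m\in\mathbb{N}$ equal sized elements $\tau_k^h$. Then the Schur complement matrix $S_h^{L} := V_h^\top D_h^{-1}V_h$ is positive definite for all $m>2$, i.e. $$(S_h^{L}\underline{w},\underline{w}) \ge \Big(\frac12-\frac1m\Big)^2\,\|w_H\|^2_{[H^1_{,0}(\Sigma)]'}\qquad\text{for all } \underline{w}\in\mathbb{R}^{N_H}\leftrightarrow w_H\in \mathcal{S}_H^0(\Sigma).$$
   Context: All functions are real-valued. $L^2(\Sigma) := L^2(0,T)\times L^2(0,T)$ and $H^1_{,0}(\Sigma) := H^1_{,0}(0,T)\times H^1_{,0}(0,T)$, where $H^1_{,0}(0,T)=\{q\in H^1(0,T): q(T)=0\}$; elements are written $u=(u_0,u_L)$, with $\|u\|^2_{L^2(\Sigma)} = \|u_0\|^2_{L^2(0,T)}+\|u_L\|^2_{L^2(0,T)}$ and $\|u\|^2_{H^1_{,0}(\Sigma)} := \|\partial_t u_0\|^2_{L^2(0,T)}+\|\partial_t u_L\|^2_{L^2(0,T)}$. $[H^1_{,0}(\Sigma)]'$ is the dual of $H^1_{,0}(\Sigma)$ with respect to $L^2(\Sigma)$ (the pairing $\langle\cdot,\cdot\rangle_\Sigma$ extends the $L^2(\Sigma)$ inner product, so $L^2(\Sigma)\subset [H^1_{,0}(\Sigma)]'$),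 with norm $\|w\|_{[H^1_{,0}(\Sigma)]'} = \sup_{0\neq v\in H^1_{,0}(\Sigma)}\langle w,v\rangle_\Sigma/\|v\|_{H^1_{,0}(\Sigma)}$. The single layer boundary integral operator of the wave equation on $(0,L)\times(0,T)$ is, for $w=(w_0,w_L)\in L^2(\Sigma)$ and $t\in(0,T)$, $$(\mathsf{V}w)(t) = \begin{pmatrix} \frac12\int_0^t w_0(s)\,ds + \frac12\int_0^{t-L} w_L(s)\,ds\\[1mm] \frac12\int_0^{t-L} w_0(s)\,ds+\frac12\int_0^t w_L(s)\,ds\end{pmatrix},$$ where integrals $\int_0^{t-L}$ are understood as $0$ for $t\le L$ (so they vanish identically when $T=L$). A mesh of $\Sigma$ consists of a decomposition of $(0,T)$ into finitely many intervals (elements) for the component at $x=0$ and another decomposition of $(0,T)$ for the component at $x=L$. $\mathcal{S}_H^0(\Sigma)=\mathrm{span}\{\phi_\ell\}_{\ell=1}^{N_H}$ and $\mathcal{S}_h^0(\Sigma)=\mathrm{span}\{\varphi_k\}_{k=1}^{N_h}$ are the spaces of piecewise constant functions on $\Sigma_H$ and $\Sigma_h$, where $\phi_\ell$ (resp. $\varphi_k$) is the indicator function of the element $\tau_\ell^H$ (resp. $\tau_k^h$) in the corresponding component, and zero in the other. The matrices are $D_h[j,k] = \langle\varphi_k,\varphi_j\rangle_{L^2(\Sigma)}$ ($j,k=1,\dots,N_h$) and $V_h[j,\ell] = \langle\mathsf{V}\phi_\ell,\varphi_j\rangle_{L^2(\Sigma)}$ ($j=1,\dots,N_h$, $\ell=1,\dots,N_H$).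 The correspondence $\underline{w}\leftrightarrow w_H$ means $w_H=\sum_{\ell=1}^{N_H} w_\ell\phi_\ell$, and $(\cdot,\cdot)$ is the Euclidean inner product on $\mathbb{R}^{N_H}$. *)

theory Defs
  imports "HOL-Analysis.Analysis"
begin

section \<open>Function spaces on the lateral boundary\<close>

text \<open>
  A function on the lateral boundary is the pair \<open>(u\<^sub>0, u\<^sub>L)\<close> of its restrictions to \<open>x = 0\<close> and
  \<open>x = L\<close>. The components are total functions on the reals, of which only the values on the time
  interval matter.
\<close>

type_synonym bfun = "(real \<Rightarrow> real) \<times> (real \<Rightarrow> real)"

definition L2 :: "real \<Rightarrow> (real \<Rightarrow> real) set" where
  "L2 T = {f \<in> borel_measurable (lebesgue_on {0<..<T}).
             integrable (lebesgue_on {0<..<T}) (\<lambda>t. (f t)\<^sup>2)}"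

definition L2_inner :: "real \<Rightarrow> (real \<Rightarrow> real) \<Rightarrow> (real \<Rightarrow> real) \<Rightarrow> real" where
  "L2_inner T f g = integral\<^sup>L (lebesgue_on {0<..<T}) (\<lambda>t. f t * g t)"

definition L2_inner_Sigma :: "real \<Rightarrow> bfun \<Rightarrow> bfun \<Rightarrow> real" where
  "L2_inner_Sigma T u v = L2_inner T (fst u) (fst v) + L2_inner T (snd u) (snd v)"

text \<open>Smooth functions with compact support in the open interval \<open>(0,T)\<close>.\<close>

definition test_functions :: "real \<Rightarrow> (real \<Rightarrow> real) set" where
  "test_functions T = {\<phi>. (\<forall>k t. (deriv ^^ k) \<phi> differentiable (at t)) \<and>
                          closure {t. \<phi> t \<noteq> 0} \<subseteq> {0<..<T}}"

definition is_weak_deriv :: "real \<Rightarrow> (real \<Rightarrow> real) \<Rightarrow> (real \<Rightarrow> real) \<Rightarrow> bool" where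
  "is_weak_deriv T q g \<longleftrightarrow> q \<in> L2 T \<and> g \<in> L2 T \<and>
     (\<forall>\<phi> \<in> test_functions T. L2_inner T q (deriv \<phi>) = - L2_inner T g \<phi>)"

text \<open>The weak derivative is unique up to null sets, so integrals do not depend on the choice.\<close>

definition weak_deriv :: "real \<Rightarrow> (real \<Rightarrow> real) \<Rightarrow> real \<Rightarrow> real" where
  "weak_deriv T q = (SOME g. is_weak_deriv T q g)"

text \<open>
  Every element of \<open>H\<^sup>1(0,T)\<close> has a unique representative that is continuous on \<open>[0,T]\<close>; it is the
  one meant in the end condition \<open>q(T) = 0\<close>.
\<close>

definition H1_0T :: "real \<Rightarrow> (real \<Rightarrow> real) set" where
  "H1_0T T = {q. continuous_on {0..T} q \<and> (\<exists>g. is_weak_deriv T q g) \<and> q T = 0}"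

definition H1_Sigma :: "real \<Rightarrow> bfun set" where
  "H1_Sigma T = H1_0T T \<times> H1_0T T"

definition H1_norm :: "real \<Rightarrow> bfun \<Rightarrow> real" where
  "H1_norm T u = sqrt (L2_inner T (weak_deriv T (fst u)) (weak_deriv T (fst u)) +
                       L2_inner T (weak_deriv T (snd u)) (weak_deriv T (snd u)))"

text \<open>
  Norm of a functional on \<open>H1_Sigma\<close>. An \<open>L\<^sup>2\<close> function \<open>w\<close> is identified with the functional
  \<open>L2_inner_Sigma T w\<close>. The condition on \<open>v\<close> says that \<open>v\<close> is not the zero element.
\<close>

definition dual_norm :: "real \<Rightarrow> (bfun \<Rightarrow> real) \<Rightarrow> real" where
  "dual_norm T F = Sup {F v / H1_norm T v | v.
     v \<in> H1_Sigma T \<and> (\<exists>t\<in>{0..T}. fst v t \<noteq> 0 \<or> snd v t \<noteq> 0)}"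


section \<open>The single layer boundary integral operator\<close>

text \<open>For \<open>t \<le> L\<close> the interval \<open>(0, t - L)\<close> is empty and the corresponding integrals vanish.\<close>

definition single_layer :: "real \<Rightarrow> bfun \<Rightarrow> bfun" where
  "single_layer L w =
    ((\<lambda>t. 1/2 * integral\<^sup>L (lebesgue_on {0<..<t}) (fst w) +
          1/2 * integral\<^sup>L (lebesgue_on {0<..<t - L}) (snd w)),
     (\<lambda>t. 1/2 * integral\<^sup>L (lebesgue_on {0<..<t - L}) (fst w) +
          1/2 * integral\<^sup>L (lebesgue_on {0<..<t}) (snd w)))"


section \<open>Meshes and piecewise constant functions\<close>

datatype side = At0 | AtL

text \<open>An element is a time interval \<open>(lo, hi)\<close> on one of the two components.\<close>

datatype element = Element (side: side) (lo: real) (hi: real)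

text \<open>
  A mesh with \<open>N\<close> elements is an injective family indexed by a finite type of cardinality \<open>N\<close>.
  The decompositions of the two components are independent of each other.
\<close>

definition is_mesh :: "real \<Rightarrow> ('i::finite \<Rightarrow> element) \<Rightarrow> bool" where
  "is_mesh T \<tau> \<longleftrightarrow> inj \<tau> \<and> (\<forall>i. lo (\<tau> i) < hi (\<tau> i)) \<and>
     (\<forall>x. {{lo e..hi e} | e. e \<in> range \<tau> \<and> side e = x} division_of {0..T})"

definition subdivide :: "nat \<Rightarrow> element \<Rightarrow> element set" where
  "subdivide m e =
     (\<lambda>i. Element (side e) (lo e + real i * (hi e - lo e) / real m)
                           (lo e + real (Suc i) * (hi e - lo e) / real m)) ` {..<m}"

text \<open>The numbering of the elements of the fine mesh \<open>\<sigma>\<close> is arbitrary.\<close>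

definition is_uniform_refinement ::
    "nat \<Rightarrow> ('l::finite \<Rightarrow> element) \<Rightarrow> ('k::finite \<Rightarrow> element) \<Rightarrow> bool" where
  "is_uniform_refinement m \<tau> \<sigma> \<longleftrightarrow> inj \<sigma> \<and> range \<sigma> = (\<Union>l. subdivide m (\<tau> l))"

definition basis_fun :: "element \<Rightarrow> bfun" where
  "basis_fun e = (case side e of
       At0 \<Rightarrow> (indicator {lo e<..<hi e}, \<lambda>_. 0)
     | AtL \<Rightarrow> (\<lambda>_. 0, indicator {lo e<..<hi e}))"

definition pc_fun :: "('l::finite \<Rightarrow> element) \<Rightarrow> real ^ 'l \<Rightarrow> bfun" where
  "pc_fun \<tau> w = ((\<lambda>t. \<Sum>l\<in>UNIV. w $ l * fst (basis_fun (\<tau> l)) t),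
                 (\<lambda>t. \<Sum>l\<in>UNIV. w $ l * snd (basis_fun (\<tau> l)) t))"


section \<open>Galerkin matrices and the Schur complement\<close>

definition D_mat :: "real \<Rightarrow> ('k::finite \<Rightarrow> element) \<Rightarrow> real ^ 'k ^ 'k" where
  "D_mat T \<sigma> = (\<chi> j k. L2_inner_Sigma T (basis_fun (\<sigma> k)) (basis_fun (\<sigma> j)))"

definition V_mat ::
    "real \<Rightarrow> real \<Rightarrow> ('l::finite \<Rightarrow> element) \<Rightarrow> ('k::finite \<Rightarrow> element) \<Rightarrow> real ^ 'l ^ 'k" where
  "V_mat L T \<tau> \<sigma> =
     (\<chi> j l. L2_inner_Sigma T (single_layer L (basis_fun (\<tau> l))) (basis_fun (\<sigma> j)))"

definition schur_mat ::
    "real \<Rightarrow> real \<Rightarrow> ('l::finite \<Rightarrow> element) \<Rightarrow> ('k::finite \<Rightarrow> element) \<Rightarrow> real ^ 'l ^ 'l" where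
  "schur_mat L T \<tau> \<sigma> =
     transpose (V_mat L T \<tau> \<sigma>) ** matrix_inv (D_mat T \<sigma>) ** V_mat L T \<tau> \<sigma>"

definition positive_definite :: "real ^ 'l ^ 'l \<Rightarrow> bool" where
  "positive_definite A \<longleftrightarrow> transpose A = A \<and> (\<forall>w. w \<noteq> 0 \<longrightarrow> (A *v w) \<bullet> w > 0)"

end

theory Submission
  imports Defs
begin

text \<open>
  Let \<open>W\<close> be the componentwise primitive of \<open>w\<^sub>H\<close> that vanishes at \<open>t = 0\<close>. For \<open>T = L\<close> the delayed
  integrals drop out, so \<open>V w\<^sub>H = W / 2\<close> and the quadratic form of the Schur complement is
  \<open>\<parallel>Q\<^sub>h W\<parallel>\<^sup>2 / 4\<close> with the \<open>L\<^sup>2\<close> projection \<open>Q\<^sub>h\<close> onto the fine mesh, i.e. it is the midpoint rule applied to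
  \<open>W\<^sup>2 / 4\<close>. On a coarse element of length \<open>d\<close>, \<open>W\<close> is affine with slope \<open>w\<^sub>l\<close> and midpoint value \<open>\<alpha>\<close>;
  there the integral of \<open>W\<^sup>2\<close> is \<open>d \<alpha>\<^sup>2 + w\<^sub>l\<^sup>2 d\<^sup>3 / 12\<close>, and the midpoint rule on \<open>m\<close> equal parts
  multiplies the second term by \<open>1 - 1 / m\<^sup>2\<close>. Hence the form is at least
  \<open>(1 - 1 / m\<^sup>2) \<parallel>W\<parallel>\<^sup>2 / 4 \<ge> (1 / 2 - 1 / m)\<^sup>2 \<parallel>W\<parallel>\<^sup>2\<close>. Integration by parts against a function that
  vanishes at \<open>T\<close> shows that the dual norm of \<open>w\<^sub>H\<close> is at most \<open>\<parallel>W\<parallel>\<close>.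
\<close>

section \<open>Smooth bump functions\<close>

text \<open>The classical smooth, non-analytic function \<open>exp (- c / x)\<close>, cut off at 0;
  the power of x absorbs the factors that differentiation produces. The parameter c lets the
  function approach a step as c tends to 0.\<close>

definition flat :: "real \<Rightarrow> nat \<Rightarrow> real \<Rightarrow> real" where
  "flat c i x = (if x > 0 then exp (- c / x) / x ^ i else 0)"

text \<open>On the right, y = c / x turns the claim into y^i / exp y tending to 0 at infinity; on
  the left the function is identically 0.\<close>

lemma flat_tendsto_0:
  assumes "c > 0"
  shows "(flat c i \<longlongrightarrow> 0) (at 0)"
proof -
  have "((\<lambda>x. (c / x) ^ i / exp (c / x)) \<longlongrightarrow> 0) (at_right 0)"
  proof (rule filterlim_compose[OF tendsto_power_div_exp_0[of i]])
    show "filterlim (\<lambda>x. c / x) at_top (at_right 0)"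
      using filterlim_tendsto_pos_mult_at_top[OF tendsto_const assms filterlim_inverse_at_top_right]
      by (simp add: divide_inverse)
  qed
  then have "((\<lambda>x. (c / x) ^ i / exp (c / x) / c ^ i) \<longlongrightarrow> 0) (at_right 0)"
    using assms by (intro tendsto_divide_zero)
  then have "(flat c i \<longlongrightarrow> 0) (at_right 0)"
  proof (rule Lim_transform_eventually)
    show "\<forall>\<^sub>F x in at_right 0. (c / x) ^ i / exp (c / x) / c ^ i = flat c i x"
      using eventually_at_right_less[of 0]
      by eventually_elim (use assms in \<open>simp add: flat_def exp_minus field_simps\<close>)
  qed
  moreover have "(flat c i \<longlongrightarrow> 0) (at_left 0)"
  proof (rule Lim_transform_eventually[OF tendsto_const])
    show "\<forall>\<^sub>F x in at_left 0. 0 = flat c i x"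
      by (auto simp: flat_def eventually_at_filter)
  qed
  ultimately show ?thesis
    by (simp add: filterlim_split_at)
qed

lemma flat_has_real_derivative:
  assumes "c > 0"
  shows "(flat c i has_real_derivative c * flat c (i + 2) x - real i * flat c (i + 1) x) (at x)"
proof (cases x "0::real" rule: linorder_cases)
  case less
  have "((\<lambda>_. 0) has_real_derivative 0) (at x)"
    by simp
  then have "(flat c i has_real_derivative 0) (at x)"
    by (rule has_field_derivative_transform_within_open[where S = "{..<0}"])
      (use less in \<open>auto simp: flat_def\<close>)
  then show ?thesis
    using less by (simp add: flat_def)
next
  case equal
  \<comment> \<open>The difference quotient at 0 is again a member of the family, with index i + 1,
    so the limit at 0 already gives the derivative.\<close>
  have "((\<lambda>h. flat c i h / h) \<longlongrightarrow> 0) (at 0)"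
  proof (rule Lim_transform_eventually[OF flat_tendsto_0[OF assms, of "i + 1"]])
    show "\<forall>\<^sub>F h in at 0. flat c (i + 1) h = flat c i h / h"
      by (simp add: flat_def eventually_at_filter)
  qed
  then show ?thesis
    using equal by (simp add: has_field_derivative_iff flat_def)
next
  case greater
  have "((\<lambda>x. exp (- c / x) / x ^ i) has_real_derivative
      c * flat c (i + 2) x - real i * flat c (i + 1) x) (at x)"
    using greater
    by (cases i) (auto intro!: derivative_eq_intros simp: flat_def divide_simps power2_eq_square algebra_simps,
      metis One_nat_def mult.commute neq0_conv power_minus_mult)
  then show ?thesis
    by (rule has_field_derivative_transform_within_open[where S = "{0<..}"])
      (use greater in \<open>auto simp: flat_def\<close>)
qed

text \<open>
  The derivative of \<open>flat c i\<close> is a combination of \<open>flat c (i + 1)\<close> and \<open>flat c (i + 2)\<close>, so this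
  family is closed under differentiation and consists of smooth functions.
\<close>

inductive_set bumps :: "(real \<Rightarrow> real) set" where
  base: "c > 0 \<Longrightarrow> (\<lambda>x. k * flat c i (x - p) * flat c j (q - x)) \<in> bumps"
| add: "f \<in> bumps \<Longrightarrow> g \<in> bumps \<Longrightarrow> (\<lambda>x. f x + g x) \<in> bumps"

lemma bumps_cmult: "f \<in> bumps \<Longrightarrow> (\<lambda>x. a * f x) \<in> bumps"
proof (induction rule: bumps.induct)
  case (base c k i p j q)
  show ?case
    using bumps.base[OF base, of "a * k" i p j q] by (simp add: mult.assoc)
next
  case (add f g)
  show ?case
    using bumps.add[OF add.IH] by (simp add: distrib_left)
qed

lemma bumps_has_derivative:
  "f \<in> bumps \<Longrightarrow> \<exists>f'\<in>bumps. \<forall>x. (f has_real_derivative f' x) (at x)"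
proof (induction rule: bumps.induct)
  case (base c k i p j q)
  let ?t = "\<lambda>k i j x. k * flat c i (x - p) * flat c j (q - x)"
  \<comment> \<open>Product rule; the inner function \<open>q - x\<close> flips both signs in the
    derivative of the second factor.\<close>
  let ?f' = "\<lambda>x. (?t (k * c) (i + 2) j x + ?t (- k * real i) (i + 1) j x) +
                (?t (- k * c) i (j + 2) x + ?t (k * real j) i (j + 1) x)"
  have "?f' \<in> bumps"
    by (intro bumps.intros base)
  moreover have "(?t k i j has_real_derivative ?f' x) (at x)" for x
  proof -
    note [derivative_intros] = flat_has_real_derivative[OF base, THEN DERIV_chain2]
    show ?thesis
      by (auto intro!: derivative_eq_intros simp: algebra_simps)
  qed
  ultimately show ?case
    by (intro bexI[of _ ?f']) blast+
next
  case (add f g)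
  then obtain f' g' where "f' \<in> bumps" "g' \<in> bumps"
    "\<And>x. (f has_real_derivative f' x) (at x)" "\<And>x. (g has_real_derivative g' x) (at x)"
    by blast
  then show ?case
    by (intro bexI[of _ "\<lambda>x. f' x + g' x"]) (auto intro!: DERIV_add bumps.add)
qed

lemma bumps_continuous: "f \<in> bumps \<Longrightarrow> isCont f x"
  using bumps_has_derivative DERIV_isCont by blast

lemma bumps_deriv: "f \<in> bumps \<Longrightarrow> deriv f \<in> bumps"
proof -
  assume "f \<in> bumps"
  then obtain f' where "f' \<in> bumps" "\<And>x. (f has_real_derivative f' x) (at x)"
    using bumps_has_derivative by blast
  moreover from this have "deriv f = f'"
    by (auto intro: DERIV_imp_deriv)
  ultimately show ?thesis
    by simp
qed

lemma bumps_smooth: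
  assumes "f \<in> bumps"
  shows "(deriv ^^ k) f differentiable (at t)"
proof -
  have "(deriv ^^ k) f \<in> bumps"
    by (induction k) (auto simp: assms bumps_deriv)
  then show ?thesis
    using bumps_has_derivative real_differentiable_def by blast
qed

text \<open>The test functions used later are antiderivatives of elements of \<open>bumps\<close>;
  from the first derivative on, everything lies in \<open>bumps\<close>.\<close>

lemma antiderivative_smooth:
  assumes "f \<in> bumps" and F: "\<And>x. (F has_real_derivative f x) (at x)"
  shows "(deriv ^^ k) F differentiable (at t)"
proof (cases k)
  case 0
  then show ?thesis
    using F real_differentiable_def by auto
next
  case (Suc j)
  have "deriv F = f"
    using F by (auto intro: DERIV_imp_deriv)
  then show ?thesis
    using bumps_smooth[OF assms(1), of j t] by (simp add: Suc funpow_Suc_right del: funpow.simps)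
qed

definition bump :: "real \<Rightarrow> real \<Rightarrow> real \<Rightarrow> real \<Rightarrow> real" where
  "bump c p q x = flat c 0 (x - p) * flat c 0 (q - x)"

lemma bump_in_bumps: "c > 0 \<Longrightarrow> bump c p q \<in> bumps"
  using bumps.base[of c 1 0 p 0 q] by (simp add: bump_def[abs_def])

lemma bump_nonneg: "0 \<le> bump c p q x"
  by (simp add: bump_def flat_def)

lemma bump_le_1: "c > 0 \<Longrightarrow> bump c p q x \<le> 1"
  by (auto simp: bump_def flat_def intro!: mult_le_one)

lemma bump_eq_0: "x \<le> p \<or> q \<le> x \<Longrightarrow> bump c p q x = 0"
  by (auto simp: bump_def flat_def)

lemma bump_pos: "p < x \<Longrightarrow> x < q \<Longrightarrow> 0 < bump c p q x"
  by (auto simp: bump_def flat_def)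

text \<open>A smooth step: the bump vanishes outside (p, q), so its antiderivative is constant on
  either side, and it is positive inside, so the step has positive height.\<close>

lemma bump_antiderivative:
  assumes "c > 0" "p < q"
  obtains F where "\<And>x. (F has_real_derivative bump c p q x) (at x)"
    "\<And>t. t \<le> p \<Longrightarrow> F t = 0" "\<And>t. q \<le> t \<Longrightarrow> F t = F q" "F q > 0"
proof -
  have cont: "isCont (bump c p q) x" for x
    using bump_in_bumps[OF assms(1)] by (rule bumps_continuous)
  \<comment> \<open>Infinite endpoints give one antiderivative on the whole line.\<close>
  obtain G where G: "\<And>x. (G has_vector_derivative bump c p q x) (at x)"
    using einterval_antiderivative[of "-\<infinity>" "\<infinity>" "bump c p q"] cont by auto
  then have G': "(G has_real_derivative bump c p q x) (at x)" for x
    by (simp add: has_real_derivative_iff_has_vector_derivative)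
  let ?F = "\<lambda>t. G t - G p"
  have F: "(?F has_real_derivative bump c p q x) (at x)" for x
    by (auto intro!: derivative_eq_intros G')
  have const: "?F s = ?F t" if "s \<le> t" "t \<le> p \<or> q \<le> s" for s t
  proof (cases "s = t")
    case False
    have "?F t = ?F s"
      using False that
      by (intro DERIV_isconst_end)
        (auto intro!: continuous_at_imp_continuous_on DERIV_isCont[OF F] F simp: bump_eq_0
          intro: DERIV_cong[OF F bump_eq_0])
    then show ?thesis by simp
  qed simp
  have "?F p < ?F q"
    using assms(2)
  proof (rule DERIV_pos_imp_increasing_open)
    show "\<exists>y. (?F has_real_derivative y) (at x) \<and> 0 < y" if "p < x" "x < q" for x
      using F bump_pos[OF that] by blast
    show "continuous_on {p..q} ?F"
      by (intro continuous_at_imp_continuous_on ballI DERIV_isCont[OF F])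
  qed
  then show thesis
    using that[of ?F] F const by (metis diff_self order_refl)
qed

section \<open>Integration by parts against weak derivatives\<close>

text \<open>Closed form of the primitive of the indicator of \<open>{a<..<b}\<close> that vanishes
  at 0, for 0 \<le> a \<le> b.\<close>

definition ramp :: "real \<Rightarrow> real \<Rightarrow> real \<Rightarrow> real" where
  "ramp a b t = max 0 (min (t - a) (b - a))"

lemma indicator_has_integral_ramp:
  assumes "0 \<le> a" "a \<le> b"
  shows "(indicator {a<..<b} has_integral ramp a b t) {0..t}"
proof -
  \<comment> \<open>The part of (a, b) before t, up to endpoints; the interval is empty when t <
    a.\<close>
  have *: "((\<lambda>_. 1) has_integral ramp a b t) {a..min b t}" 
  proof (cases "a \<le> min b t")
    case True
    then have "ramp a b t = min b t - a"
      by (auto simp: ramp_def)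
    then show ?thesis
      using has_integral_const_real[of "1::real" a "min b t"] True by simp
  next
    case False
    then have "ramp a b t = 0"
      using assms by (auto simp: ramp_def)
    then show ?thesis
      using False by simp
  qed
  have "((\<lambda>x. if x \<in> {a..min b t} then 1 else 0) has_integral ramp a b t) {0..t}"
    using * by (rule has_integral_on_superset[where T = "{0..t}", OF has_integral_restrict[THEN iffD2, rotated]])
      (use assms in auto)
  then show ?thesis
    by (rule has_integral_spike[where S = "{a, b}", rotated 2]) (auto simp: indicator_def)
qed

section \<open>Integrability and dominated convergence against square-integrable functions\<close>

text \<open>The interval has finite measure, and the absolute value of f is at most 1 + f^2.\<close>

lemma L2_integrable:
  assumes "f \<in> L2 T"
  shows "integrable (lebesgue_on {0<..<T}) f"
proof -
  interpret finite_measure "lebesgue_on {0<..<T}"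
    by (rule finite_measure_lebesgue_on) simp
  show ?thesis
  proof (rule Bochner_Integration.integrable_bound)
    show "integrable (lebesgue_on {0<..<T}) (\<lambda>t. 1 + (f t)\<^sup>2)"
      using assms by (auto simp: L2_def)
    show "AE t in lebesgue_on {0<..<T}. norm (f t) \<le> norm (1 + (f t)\<^sup>2)"
    proof (rule AE_I2)
      fix t
      have "0 \<le> (\<bar>f t\<bar> - 1)\<^sup>2"
        by simp
      then have "2 * \<bar>f t\<bar> \<le> 1 + (f t)\<^sup>2"
        by (simp add: power2_diff)
      then show "norm (f t) \<le> norm (1 + (f t)\<^sup>2)"
        by simp
    qed
  qed (use assms in \<open>simp add: L2_def\<close>)
qed

lemma L2_measurable: "f \<in> L2 T \<Longrightarrow> f \<in> borel_measurable (lebesgue_on {0<..<T})"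
  by (simp add: L2_def)

lemma L2_mult_bounded_integrable:
  assumes "f \<in> L2 T" "h \<in> borel_measurable (lebesgue_on {0<..<T})"
    and "\<And>t. t \<in> {0<..<T} \<Longrightarrow> \<bar>h t\<bar> \<le> B"
  shows "integrable (lebesgue_on {0<..<T}) (\<lambda>t. f t * h t)"
proof (rule Bochner_Integration.integrable_bound)
  show "integrable (lebesgue_on {0<..<T}) (\<lambda>t. f t * B)"
    using L2_integrable[OF assms(1)] by simp
  show "(\<lambda>t. f t * h t) \<in> borel_measurable (lebesgue_on {0<..<T})"
    using L2_measurable[OF assms(1)] assms(2) by (rule borel_measurable_times)
  show "AE t in lebesgue_on {0<..<T}. norm (f t * h t) \<le> norm (f t * B)"
    using assms(3) by (auto simp: abs_mult intro!: AE_I2 mult_left_mono) fastforce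
qed

lemma indicator_Ioo_measurable:
  "indicator {p<..<q} \<in> borel_measurable (lebesgue_on {0<..<T :: real})"
  by (intro measurable_restrict_space1 borel_measurable_indicator) simp

lemma L2_inner_tendsto:
  assumes "f \<in> L2 T"
    and "\<And>n. h n \<in> borel_measurable (lebesgue_on {0<..<T})" "h' \<in> borel_measurable (lebesgue_on {0<..<T})"
    and "\<And>n t. t \<in> {0<..<T} \<Longrightarrow> \<bar>h n t\<bar> \<le> B"
    and "\<And>t. t \<in> {0<..<T} \<Longrightarrow> (\<lambda>n. h n t) \<longlonglongrightarrow> h' t"
  shows "(\<lambda>n. L2_inner T f (h n)) \<longlonglongrightarrow> L2_inner T f h'"
  unfolding L2_inner_def
proof (rule integral_dominated_convergence)
  show "integrable (lebesgue_on {0<..<T}) (\<lambda>t. \<bar>f t\<bar> * B)"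
    using L2_integrable[OF assms(1)] by simp
  show "AE t in lebesgue_on {0<..<T}. (\<lambda>n. f t * h n t) \<longlonglongrightarrow> f t * h' t"
    using assms(5) by (intro AE_I2 tendsto_mult_left) simp
  show "AE t in lebesgue_on {0<..<T}. norm (f t * h n t) \<le> \<bar>f t\<bar> * B" for n
    using assms(4) by (auto simp: abs_mult intro!: AE_I2 mult_left_mono)
qed (intro borel_measurable_times L2_measurable[OF assms(1)] assms)+

text \<open>Inside (a, b) both exponents tend to 0, so both factors tend to 1; elsewhere every bump
  is 0. Shrinking the interval by \<open>\<epsilon> n\<close> keeps the supports away from a and
  b.\<close>

lemma bump_tendsto_indicator:
  assumes "\<epsilon> \<longlonglongrightarrow> 0" "\<And>n. \<epsilon> n > 0"
  shows "(\<lambda>n. bump (\<epsilon> n) (a + \<epsilon> n) (b - \<epsilon> n) t) \<longlonglongrightarrow> indicator {a<..<b} t"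
proof (cases "t \<in> {a<..<b}")
  case True
  have 1: "(\<lambda>n. t - (a + \<epsilon> n)) \<longlonglongrightarrow> t - (a + 0)" "(\<lambda>n. b - \<epsilon> n - t) \<longlonglongrightarrow> b - 0 - t"
    by (intro tendsto_intros assms(1))+
  then have "(\<lambda>n. exp (- \<epsilon> n / (t - (a + \<epsilon> n))) * exp (- \<epsilon> n / (b - \<epsilon> n - t)))
      \<longlonglongrightarrow> exp (- 0 / (t - (a + 0))) * exp (- 0 / (b - 0 - t))"
    using True by (intro tendsto_intros assms(1)) auto
  moreover have "\<forall>\<^sub>F n in sequentially. t - (a + \<epsilon> n) > 0" "\<forall>\<^sub>F n in sequentially. b - \<epsilon> n - t > 0"
    using order_tendstoD(1)[OF 1(1), of 0] order_tendstoD(1)[OF 1(2), of 0] True by auto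
  then have "\<forall>\<^sub>F n in sequentially. exp (- \<epsilon> n / (t - (a + \<epsilon> n))) * exp (- \<epsilon> n / (b - \<epsilon> n - t)) =
      bump (\<epsilon> n) (a + \<epsilon> n) (b - \<epsilon> n) t"
    by eventually_elim (simp add: bump_def flat_def)
  ultimately have "(\<lambda>n. bump (\<epsilon> n) (a + \<epsilon> n) (b - \<epsilon> n) t)
      \<longlonglongrightarrow> exp (- 0 / (t - (a + 0))) * exp (- 0 / (b - 0 - t))"
    by (rule Lim_transform_eventually)
  then show ?thesis
    using True by simp
next
  case False
  then have "bump (\<epsilon> n) (a + \<epsilon> n) (b - \<epsilon> n) t = 0" for n
    using assms(2)[of n] by (intro bump_eq_0) auto
  then show ?thesis
    using False by simp
qed


lemma antiderivative_has_integral: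
  assumes "\<And>x. (F has_real_derivative f x) (at x)" "a \<le> b"
  shows "(f has_integral F b - F a) {a..b}"
  using assms
  by (intro fundamental_theorem_of_calculus)
    (auto simp: has_real_derivative_iff_has_vector_derivative[symmetric] intro: DERIV_subset)

lemma L2_inner_cmult_right: "L2_inner T f (\<lambda>t. c * g t) = c * L2_inner T f g"
  by (simp add: L2_inner_def mult.left_commute)

lemma L2_inner_diff_right:
  assumes "integrable (lebesgue_on {0<..<T}) (\<lambda>t. f t * g t)"
    and "integrable (lebesgue_on {0<..<T}) (\<lambda>t. f t * h t)"
  shows "L2_inner T f (\<lambda>t. g t - h t) = L2_inner T f g - L2_inner T f h"
  using assms by (simp add: L2_inner_def right_diff_distrib)

lemma continuous_measurable_lebesgue_on:
  assumes "\<And>x. isCont f x"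
  shows "f \<in> borel_measurable (lebesgue_on {0<..<T :: real})"
  using assms
  by (intro continuous_imp_measurable_on_sets_lebesgue continuous_at_imp_continuous_on) auto

lemma bump_integral:
  assumes "c > 0" "0 \<le> T" "\<And>x. (F has_real_derivative bump c p q x) (at x)"
  shows "integrable (lebesgue_on {0<..<T}) (bump c p q)"
    and "integral\<^sup>L (lebesgue_on {0<..<T}) (bump c p q) = F T - F 0"
proof -
  have cont: "isCont (bump c p q) x" for x
    using bump_in_bumps[OF assms(1)] by (rule bumps_continuous)
  interpret finite_measure "lebesgue_on {0<..<T}"
    by (rule finite_measure_lebesgue_on) simp
  show int: "integrable (lebesgue_on {0<..<T}) (bump c p q)"
    using continuous_measurable_lebesgue_on[OF cont] bump_le_1[OF assms(1)] bump_nonneg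
    by (intro integrable_const_bound[of _ 1]) (auto intro!: AE_I2)
  have "(bump c p q has_integral F T - F 0) {0..T}"
    using assms(3,2) by (rule antiderivative_has_integral)
  then have "(bump c p q has_integral F T - F 0) {0<..<T}"
    by (simp add: has_integral_Icc_iff_Ioo)
  then show "integral\<^sup>L (lebesgue_on {0<..<T}) (bump c p q) = F T - F 0"
    using lebesgue_integral_eq_integral[OF int] by (simp add: integral_unique)
qed

lemma antiderivative_bump_mono:
  assumes "\<And>x. (F has_real_derivative bump c p q x) (at x)" "s \<le> t"
  shows "F s \<le> F t"
  using assms(2) by (rule DERIV_nonneg_imp_nondecreasing) (use assms(1) bump_nonneg in blast)

text \<open>
  The ramp is not a test function. It is approximated by \<open>P n - c n * R n\<close>, where \<open>P n\<close> is a
  smooth ramp that vanishes near \<open>0\<close> and \<open>R n\<close> is a smooth step close to \<open>T\<close>, scaled so that the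
  difference vanishes near \<open>T\<close>. The step contributes \<open>q T = 0\<close> in the limit.
\<close>

lemma L2_inner_indicator_eq_ramp:
  assumes "T > 0" "q \<in> H1_0T T" "is_weak_deriv T q g" "0 \<le> a" "a < b" "b \<le> T"
  shows "L2_inner T q (indicator {a<..<b}) = - L2_inner T g (ramp a b)"
proof -
  have qcont: "continuous_on {0..T} q" and qT: "q T = 0"
    using assms(2) by (auto simp: H1_0T_def)
  have qL2: "q \<in> L2 T" and gL2: "g \<in> L2 T"
    and weak: "\<And>\<phi>. \<phi> \<in> test_functions T \<Longrightarrow> L2_inner T q (deriv \<phi>) = - L2_inner T g \<phi>"
    using assms(3) by (auto simp: is_weak_deriv_def)
  \<comment> \<open>The offset 3 makes 3 \<open>\<epsilon> n\<close> \<le> b - a, so the shrunken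
    interval is nonempty and the step near T starts after 0, for every n.\<close>
  define \<epsilon> where "\<epsilon> n = (b - a) / real (n + 3)" for n
  have \<epsilon>_pos: "\<epsilon> n > 0" and \<epsilon>_le: "3 * \<epsilon> n \<le> b - a" for n
    using assms(5) by (auto simp: \<epsilon>_def field_simps intro: mult_right_mono)
  have \<epsilon>_lim: "\<epsilon> \<longlonglongrightarrow> 0"
    unfolding \<epsilon>_def by (rule LIMSEQ_ignore_initial_segment[OF lim_const_over_n])
  have order: "a + \<epsilon> n < b - \<epsilon> n" "0 < T - 2 * \<epsilon> n" "T - 2 * \<epsilon> n < T - \<epsilon> n" for n
    using \<epsilon>_pos[of n] \<epsilon>_le[of n] assms(4-6) by linarith+
  define \<psi> where "\<psi> n = bump (\<epsilon> n) (a + \<epsilon> n) (b - \<epsilon> n)" for n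
  \<comment> \<open>The parameter stays 1 here: only the mass of \<open>\<rho> n\<close> matters,
    since \<open>c n\<close> rescales it.\<close>
  define \<rho> where "\<rho> n = bump 1 (T - 2 * \<epsilon> n) (T - \<epsilon> n)" for n
  have "\<exists>F. (\<forall>x. (F has_real_derivative \<psi> n x) (at x)) \<and> (\<forall>t\<le>a + \<epsilon> n. F t = 0) \<and>
      (\<forall>t\<ge>b - \<epsilon> n. F t = F (b - \<epsilon> n))" for n
    using bump_antiderivative[OF \<epsilon>_pos order(1)] unfolding \<psi>_def by metis
  then obtain P where P: "\<And>n x. (P n has_real_derivative \<psi> n x) (at x)"
      "\<And>n t. t \<le> a + \<epsilon> n \<Longrightarrow> P n t = 0" "\<And>n t. b - \<epsilon> n \<le> t \<Longrightarrow> P n t = P n (b - \<epsilon> n)"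
    by metis
  have "\<exists>F. (\<forall>x. (F has_real_derivative \<rho> n x) (at x)) \<and> (\<forall>t\<le>T - 2 * \<epsilon> n. F t = 0) \<and>
      (\<forall>t\<ge>T - \<epsilon> n. F t = F (T - \<epsilon> n)) \<and> F (T - \<epsilon> n) > 0" for n
    using bump_antiderivative[OF zero_less_one order(3)] unfolding \<rho>_def by metis
  then obtain R where R: "\<And>n x. (R n has_real_derivative \<rho> n x) (at x)"
      "\<And>n t. t \<le> T - 2 * \<epsilon> n \<Longrightarrow> R n t = 0" "\<And>n t. T - \<epsilon> n \<le> t \<Longrightarrow> R n t = R n (T - \<epsilon> n)"
      "\<And>n. R n (T - \<epsilon> n) > 0"
    by metis
  \<comment> \<open>Chosen so that \<open>\<phi> n\<close> vanishes from
    \<open>T - \<epsilon> n\<close> on.\<close>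
  define c where "c n = P n T / R n T" for n
  define \<phi> where "\<phi> n t = P n t - c n * R n t" for n t
  have RT: "R n T > 0" for n
    using R(3)[of n T] R(4)[of n] \<epsilon>_pos[of n] by simp
  have PT: "P n t = P n T" if "b - \<epsilon> n \<le> t" for n t
    using P(3)[OF that] P(3)[of n T] assms(6) \<epsilon>_pos[of n] by simp
  have RT': "R n t = R n T" if "T - \<epsilon> n \<le> t" for n t
    using R(3)[OF that] R(3)[of n T] \<epsilon>_pos[of n] by simp
  have cR: "c n * R n T = P n T" for n
    using RT[of n] by (simp add: c_def)
  have P0: "P n 0 = 0" for n
    using P(2)[of 0 n] assms(4) \<epsilon>_pos[of n] by simp
  have R0: "R n 0 = 0" for n
    using R(2)[of 0 n] order(2)[of n] by simp
  have P_int: "(\<psi> n has_integral P n t) {0..t}" if "0 \<le> t" for n t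
    using antiderivative_has_integral[of "P n" "\<psi> n", OF P(1) that] P0 by simp
  \<comment> \<open>The derivatives \<open>\<psi> n\<close> are bounded by 1 and tend to the
    indicator, so dominated convergence applies to their integrals.\<close>
  have P_lim: "(\<lambda>n. P n t) \<longlonglongrightarrow> ramp a b t" if "0 \<le> t" for t
  proof -
    have "(\<lambda>n. integral {0..t} (\<psi> n)) \<longlonglongrightarrow> integral {0..t} (indicator {a<..<b})"
    proof (rule dominated_convergence)
      show "\<psi> n integrable_on {0..t}" for n
        using P_int[OF that] by blast
      show "(\<lambda>_. 1 :: real) integrable_on {0..t}"
        by (intro integrable_continuous_real continuous_intros)
      show "norm (\<psi> n x) \<le> 1" for n x
        using bump_le_1[OF \<epsilon>_pos] bump_nonneg by (simp add: \<psi>_def)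
      show "(\<lambda>n. \<psi> n x) \<longlonglongrightarrow> indicator {a<..<b} x" for x
        unfolding \<psi>_def by (rule bump_tendsto_indicator[OF \<epsilon>_lim \<epsilon>_pos])
    qed
    then show ?thesis
      using P_int[OF that] indicator_has_integral_ramp[of a b t] assms(4,5)
      by (simp add: integral_unique[OF P_int[OF that]] integral_unique)
  qed
  have P_mono: "P n s \<le> P n t" if "s \<le> t" for n s t
    using antiderivative_bump_mono[OF P(1)[unfolded \<psi>_def] that] .
  have R_mono: "R n s \<le> R n t" if "s \<le> t" for n s t
    using antiderivative_bump_mono[OF R(1)[unfolded \<rho>_def] that] .
  have P_le_T: "P n T \<le> T" for n
  proof (rule has_integral_le[OF P_int])
    show "((\<lambda>_. 1) has_integral T) {0..T}"
      using has_integral_const_real[of "1::real" 0 T] assms(1) by simp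
    show "\<psi> n x \<le> 1" for x
      using bump_le_1[OF \<epsilon>_pos] by (simp add: \<psi>_def)
  qed (use assms(1) in simp)
  have c_nonneg: "0 \<le> c n" for n
    using P_mono[of 0 T n] P0[of n] RT[of n] assms(1) by (simp add: c_def)
  \<comment> \<open>\<open>c n\<close> grows without bound as the step narrows, but the product with
    \<open>R n\<close> stays between 0 and the final value of \<open>P n\<close>.\<close>
  have cR_bounds: "0 \<le> c n * R n t" "c n * R n t \<le> P n T" if "t \<in> {0<..<T}" for n t
    using R_mono[of 0 t n] R_mono[of t T n] R0[of n] that c_nonneg[of n] cR[of n]
      mult_left_mono[of "R n t" "R n T" "c n"] by auto
  have P_bounds: "0 \<le> P n t" "P n t \<le> P n T" if "t \<in> {0<..<T}" for n t
    using P_mono[of 0 t n] P_mono[of t T n] P0[of n] that by auto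

  have \<psi>_bumps: "\<psi> n \<in> bumps" and \<rho>_bumps: "\<rho> n \<in> bumps" for n
    by (simp_all add: \<psi>_def \<rho>_def bump_in_bumps \<epsilon>_pos)
  have \<phi>': "(\<phi> n has_real_derivative \<psi> n x - c n * \<rho> n x) (at x)" for n x
    unfolding \<phi>_def by (intro DERIV_diff DERIV_cmult P R)
  have deriv_\<phi>: "deriv (\<phi> n) = (\<lambda>x. \<psi> n x - c n * \<rho> n x)" for n
    using \<phi>' by (auto intro: DERIV_imp_deriv)
  have "\<phi> n \<in> test_functions T" for n
  proof -
    have "(\<lambda>x. \<psi> n x + - c n * \<rho> n x) \<in> bumps"
      by (intro bumps.add bumps_cmult \<psi>_bumps \<rho>_bumps)
    then have smooth: "(deriv ^^ k) (\<phi> n) differentiable (at t)" for k t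
      using \<phi>' by (intro antiderivative_smooth[of "\<lambda>x. \<psi> n x + - c n * \<rho> n x"]) auto
    \<comment> \<open>A closed interval inside (0, T) that contains the nonzero set and hence its
      closure. The minimum is needed because either \<open>P n\<close> or \<open>R n\<close> may
      start first.\<close>
    let ?S = "{min (a + \<epsilon> n) (T - 2 * \<epsilon> n)..T - \<epsilon> n}"
    have "t \<in> ?S" if "\<phi> n t \<noteq> 0" for t
    proof (rule ccontr)
      assume "t \<notin> ?S"
      then consider "t \<le> a + \<epsilon> n" "t \<le> T - 2 * \<epsilon> n" | "T - \<epsilon> n \<le> t"
        by fastforce
      then have "\<phi> n t = 0"
      proof cases
        case 1
        then show ?thesis
          using P(2) R(2) by (simp add: \<phi>_def)
      next
        case 2
        then show ?thesis
          using PT[of n t] RT'[of n t] cR[of n] assms(6) by (simp add: \<phi>_def)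
      qed
      with that show False by simp
    qed
    then have "closure {t. \<phi> n t \<noteq> 0} \<subseteq> ?S"
      by (intro closure_minimal) auto
    also have "?S \<subseteq> {0<..<T}"
      using order(2)[of n] \<epsilon>_pos[of n] assms(4) by auto
    finally show ?thesis
      using smooth by (simp add: test_functions_def)
  qed
  note weak_\<phi> = weak[OF this, unfolded deriv_\<phi>]

  have bump_cont: "isCont (\<psi> n) x" "isCont (\<rho> n) x" for n x
    using \<psi>_bumps \<rho>_bumps bumps_continuous by blast+
  have meas: "\<psi> n \<in> borel_measurable (lebesgue_on {0<..<T})"
      "\<rho> n \<in> borel_measurable (lebesgue_on {0<..<T})"
      "\<phi> n \<in> borel_measurable (lebesgue_on {0<..<T})" for n
    using bump_cont DERIV_isCont[OF \<phi>'] by (blast intro: continuous_measurable_lebesgue_on)+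
  have \<psi>_lim: "(\<lambda>n. L2_inner T q (\<psi> n)) \<longlonglongrightarrow> L2_inner T q (indicator {a<..<b})"
  proof (rule L2_inner_tendsto[OF qL2 meas(1)])
    show "\<bar>\<psi> n t\<bar> \<le> 1" for n t
      using bump_le_1[OF \<epsilon>_pos] bump_nonneg by (simp add: \<psi>_def)
    show "(\<lambda>n. \<psi> n t) \<longlonglongrightarrow> indicator {a<..<b} t" for t
      unfolding \<psi>_def by (rule bump_tendsto_indicator[OF \<epsilon>_lim \<epsilon>_pos])
    show "indicator {a<..<b} \<in> borel_measurable (lebesgue_on {0<..<T})"
      by (rule indicator_Ioo_measurable)
  qed
  have \<rho>_lim: "(\<lambda>n. c n * L2_inner T q (\<rho> n)) \<longlonglongrightarrow> 0"
  proof (rule LIMSEQ_I)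
    fix r :: real
    assume "r > 0"
    \<comment> \<open>The estimate below ends in \<open>\<eta> * T\<close>, which is r / 2.\<close>
    define \<eta> where "\<eta> = r / (2 * T)"
    have "\<eta> > 0"
      using \<open>r > 0\<close> assms(1) by (simp add: \<eta>_def)
    have "(q \<longlongrightarrow> q T) (at T within {0..T})"
      using qcont assms(1) by (simp add: continuous_on_def)
    then have "\<forall>\<^sub>F t in at T within {0..T}. dist (q t) (q T) < \<eta>"
      using \<open>\<eta> > 0\<close> by (rule tendstoD)
    then obtain d where "d > 0" and d: "\<And>t. t \<in> {0..T} \<Longrightarrow> t \<noteq> T \<Longrightarrow> dist t T < d \<Longrightarrow> \<bar>q t\<bar> < \<eta>"
      using qT by (auto simp: eventually_at)
    \<comment> \<open>The support of \<open>\<rho> n\<close> reaches 2 \<open>\<epsilon> n\<close>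
      below T, so it must fit into the d-neighbourhood where q is small.\<close>
    have "\<forall>\<^sub>F n in sequentially. \<epsilon> n < d / 2"
      using order_tendstoD(2)[OF \<epsilon>_lim, of "d / 2"] \<open>d > 0\<close> by simp
    then obtain N where N: "\<And>n. n \<ge> N \<Longrightarrow> \<epsilon> n < d / 2"
      by (auto simp: eventually_sequentially)
    show "\<exists>N. \<forall>n\<ge>N. norm (c n * L2_inner T q (\<rho> n) - 0) < r"
    proof (intro exI[of _ N] allI impI)
      fix n
      assume "n \<ge> N"
      have small: "\<bar>q t\<bar> \<le> \<eta>" if "t \<in> {T - 2 * \<epsilon> n<..<T - \<epsilon> n}" for t
        using that N[OF \<open>n \<ge> N\<close>] order(2)[of n] \<epsilon>_pos[of n]
        by (intro less_imp_le d) (auto simp: dist_real_def)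
      have int: "integrable (lebesgue_on {0<..<T}) (\<rho> n)"
          "integral\<^sup>L (lebesgue_on {0<..<T}) (\<rho> n) = R n T"
        using bump_integral[OF zero_less_one, of T "R n" "T - 2 * \<epsilon> n" "T - \<epsilon> n"] R(1) R0 assms(1)
        by (auto simp: \<rho>_def)
      have le: "\<bar>q t * \<rho> n t\<bar> \<le> \<eta> * \<rho> n t" for t
      proof (cases "t \<in> {T - 2 * \<epsilon> n<..<T - \<epsilon> n}")
        case True
        then show ?thesis
          using small bump_nonneg by (auto simp: \<rho>_def abs_mult intro!: mult_right_mono)
      next
        case False
        then have "\<rho> n t = 0"
          unfolding \<rho>_def by (intro bump_eq_0) auto
        then show ?thesis
          by simp
      qed
      have "\<bar>L2_inner T q (\<rho> n)\<bar> \<le> integral\<^sup>L (lebesgue_on {0<..<T}) (\<lambda>t. \<bar>q t * \<rho> n t\<bar>)"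
        unfolding L2_inner_def by (rule integral_abs_bound)
      also have "\<dots> \<le> integral\<^sup>L (lebesgue_on {0<..<T}) (\<lambda>t. \<eta> * \<rho> n t)"
      proof (rule integral_mono)
        show "integrable (lebesgue_on {0<..<T}) (\<lambda>t. \<bar>q t * \<rho> n t\<bar>)"
          using L2_mult_bounded_integrable[OF qL2 meas(2)[of n], of 1]
            bump_le_1[OF zero_less_one] bump_nonneg by (simp add: \<rho>_def)
      qed (use le int in auto)
      also have "\<dots> = \<eta> * R n T"
        by (simp add: int)
      finally have "\<bar>c n * L2_inner T q (\<rho> n)\<bar> \<le> c n * (\<eta> * R n T)"
        using c_nonneg[of n] by (simp add: abs_mult mult_left_mono)
      \<comment> \<open>The mass of \<open>\<rho> n\<close> is \<open>R n T\<close>, which cancels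
        the growth of \<open>c n\<close>.\<close>
      also have "\<dots> = \<eta> * P n T"
        using cR[of n] by (simp add: mult.left_commute)
      also have "\<dots> \<le> \<eta> * T"
        using P_le_T \<open>\<eta> > 0\<close> by (intro mult_left_mono) auto
      also have "\<dots> < r"
        using assms(1) \<open>r > 0\<close> by (simp add: \<eta>_def)
      finally show "norm (c n * L2_inner T q (\<rho> n) - 0) < r"
        by simp
    qed
  qed
  have \<phi>_lim: "(\<lambda>n. L2_inner T g (\<phi> n)) \<longlonglongrightarrow> L2_inner T g (ramp a b)"
  proof (rule L2_inner_tendsto[OF gL2 meas(3)])
    show "\<bar>\<phi> n t\<bar> \<le> T" if "t \<in> {0<..<T}" for n t
      using P_bounds[OF that, of n] cR_bounds[OF that, of n] P_le_T[of n] by (simp add: \<phi>_def)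
    show "ramp a b \<in> borel_measurable (lebesgue_on {0<..<T})"
      unfolding ramp_def[abs_def] by (intro continuous_measurable_lebesgue_on continuous_intros)
    show "(\<lambda>n. \<phi> n t) \<longlonglongrightarrow> ramp a b t" if "t \<in> {0<..<T}" for t
    proof (rule Lim_transform_eventually)
      show "(\<lambda>n. P n t) \<longlonglongrightarrow> ramp a b t"
        using that by (intro P_lim) simp
      \<comment> \<open>For fixed t < T the step eventually starts after t, so the correction is 0
        there.\<close>
      have "\<forall>\<^sub>F n in sequentially. \<epsilon> n < (T - t) / 2"
        using order_tendstoD(2)[OF \<epsilon>_lim, of "(T - t) / 2"] that by simp
      then show "\<forall>\<^sub>F n in sequentially. P n t = \<phi> n t"
        by eventually_elim (simp add: \<phi>_def R(2))
    qed
  qed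
  have "L2_inner T q (\<psi> n) - c n * L2_inner T q (\<rho> n) = - L2_inner T g (\<phi> n)" for n
  proof -
    have "integrable (lebesgue_on {0<..<T}) (\<lambda>t. q t * \<psi> n t)"
        "integrable (lebesgue_on {0<..<T}) (\<lambda>t. q t * \<rho> n t)"
      using L2_mult_bounded_integrable[OF qL2 meas(1)[of n], of 1]
        L2_mult_bounded_integrable[OF qL2 meas(2)[of n], of 1] bump_le_1[OF \<epsilon>_pos]
        bump_le_1[OF zero_less_one] bump_nonneg
      by (auto simp: \<psi>_def \<rho>_def)
    then show ?thesis
      using weak_\<phi>[of n] by (subst (asm) L2_inner_diff_right) (simp_all add: L2_inner_cmult_right mult.left_commute)
  qed
  then have "(\<lambda>n. - L2_inner T g (\<phi> n)) \<longlonglongrightarrow> L2_inner T q (indicator {a<..<b}) - 0"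
    using tendsto_diff[OF \<psi>_lim \<rho>_lim] by simp
  then show ?thesis
    using LIMSEQ_unique[OF _ tendsto_minus[OF \<phi>_lim]] by simp
qed

section \<open>The inner product on L2: Cauchy-Schwarz and explicit integrals\<close>

lemma L2_mult_integrable:
  assumes "f \<in> L2 T" "g \<in> L2 T"
  shows "integrable (lebesgue_on {0<..<T}) (\<lambda>t. f t * g t)"
proof (rule Bochner_Integration.integrable_bound)
  show "integrable (lebesgue_on {0<..<T}) (\<lambda>t. (f t)\<^sup>2 + (g t)\<^sup>2)"
    using assms by (auto simp: L2_def)
  show "(\<lambda>t. f t * g t) \<in> borel_measurable (lebesgue_on {0<..<T})"
    using assms[THEN L2_measurable] by (rule borel_measurable_times)
  show "AE t in lebesgue_on {0<..<T}. norm (f t * g t) \<le> norm ((f t)\<^sup>2 + (g t)\<^sup>2)"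
  proof (rule AE_I2)
    fix t
    have "2 * \<bar>f t * g t\<bar> \<le> (f t)\<^sup>2 + (g t)\<^sup>2"
      using sum_squares_bound[of "\<bar>f t\<bar>" "\<bar>g t\<bar>"] by (simp add: abs_mult)
    then show "norm (f t * g t) \<le> norm ((f t)\<^sup>2 + (g t)\<^sup>2)"
      by simp
  qed
qed

lemma L2_inner_nonneg: "0 \<le> L2_inner T f f"
  by (simp add: L2_inner_def)

text \<open>The quadratic polynomial in x given by the squared norm of f - x g is
  nonnegative.\<close>

lemma L2_Cauchy_Schwarz:
  assumes "f \<in> L2 T" "g \<in> L2 T"
  shows "\<bar>L2_inner T f g\<bar> \<le> sqrt (L2_inner T f f) * sqrt (L2_inner T g g)"
proof -
  let ?A = "L2_inner T f f" and ?B = "L2_inner T f g" and ?C = "L2_inner T g g"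
  have quad: "0 \<le> ?A - 2 * x * ?B + x\<^sup>2 * ?C" for x
  proof -
    note int = L2_mult_integrable[OF assms(1) assms(1)] L2_mult_integrable[OF assms]
      L2_mult_integrable[OF assms(2) assms(2)]
    have "0 \<le> integral\<^sup>L (lebesgue_on {0<..<T}) (\<lambda>t. (f t - x * g t)\<^sup>2)"
      by simp
    also have "(\<lambda>t. (f t - x * g t)\<^sup>2) =
        (\<lambda>t. f t * f t - 2 * x * (f t * g t) + x\<^sup>2 * (g t * g t))"
      by (auto simp: power2_eq_square algebra_simps)
    also have "integral\<^sup>L (lebesgue_on {0<..<T}) \<dots> = ?A - 2 * x * ?B + x\<^sup>2 * ?C"
      using int by (simp add: L2_inner_def)
    finally show ?thesis .
  qed
  have "?B\<^sup>2 \<le> ?A * ?C"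
  proof (cases "?C = 0")
    case True
    have "?B = 0"
    proof (rule ccontr)
      assume "?B \<noteq> 0"
      then show False
        \<comment> \<open>Without a quadratic term the polynomial is affine; this x gives it the
          value -1.\<close>
        using quad[of "(?A + 1) / (2 * ?B)"] True by simp
    qed
    then show ?thesis
      using True by simp
  next
    case False
    then have "?C > 0"
      using L2_inner_nonneg[of T g] by simp
    then show ?thesis
      \<comment> \<open>The minimiser of the polynomial.\<close>
      using quad[of "?B / ?C"] by (simp add: field_simps power2_eq_square)
  qed
  then have "sqrt (?B\<^sup>2) \<le> sqrt (?A * ?C)"
    by (rule real_sqrt_le_mono)
  then show ?thesis
    by (simp only: real_sqrt_mult real_sqrt_abs)
qed

lemma continuous_L2:
  assumes "\<And>x. isCont f x"
  shows "f \<in> L2 T"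
proof -
  have "continuous_on {0..T} (\<lambda>t. (f t)\<^sup>2)"
    using assms by (intro continuous_intros continuous_at_imp_continuous_on) auto
  then have "(\<lambda>t. (f t)\<^sup>2) absolutely_integrable_on {0..T}"
    by (rule absolutely_integrable_continuous_real)
  then have "(\<lambda>t. (f t)\<^sup>2) absolutely_integrable_on {0<..<T}"
    by (rule set_integrable_subset) auto
  then show ?thesis
    using continuous_measurable_lebesgue_on[OF assms]
    by (simp add: L2_def set_integrable_def integrable_restrict_space)
qed

text \<open>Passes from the Lebesgue integral of the definitions to the gauge integral, where the
  fundamental theorem of calculus is available; endpoints do not count.\<close>

lemma integral_lebesgue_on_Ioo:
  assumes "integrable (lebesgue_on {0<..<T :: real}) f" "(f has_integral I) {0..T}"
  shows "integral\<^sup>L (lebesgue_on {0<..<T}) f = (I :: real)"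
  using lebesgue_integral_eq_integral[OF assms(1)] assms(2)
  by (simp add: has_integral_Icc_iff_Ioo integral_unique)

lemma L2_inner_continuous:
  assumes "\<And>x. isCont f x"
  shows "L2_inner T f f = integral {0..T} (\<lambda>t. (f t)\<^sup>2)"
  unfolding L2_inner_def power2_eq_square
proof (intro integral_lebesgue_on_Ioo integrable_integral)
  show "integrable (lebesgue_on {0<..<T}) (\<lambda>t. f t * f t)"
    by (intro L2_mult_integrable continuous_L2 assms)
  show "(\<lambda>t. f t * f t) integrable_on {0..T}"
    using assms by (intro integrable_continuous_real continuous_intros continuous_at_imp_continuous_on) auto
qed

lemma indicator_L2: "indicator {p<..<q} \<in> L2 T"
proof -
  interpret finite_measure "lebesgue_on {0<..<T}"
    by (rule finite_measure_lebesgue_on) simp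
  have "integrable (lebesgue_on {0<..<T}) (indicator {p<..<q} :: real \<Rightarrow> real)"
    by (intro integrable_const_bound[of _ 1] indicator_Ioo_measurable)
      (auto intro!: AE_I2 simp: indicator_def)
  moreover have "(\<lambda>t. (indicator {p<..<q} t :: real)\<^sup>2) = indicator {p<..<q}"
    by (auto simp: indicator_def)
  ultimately show ?thesis
    by (simp only: L2_def mem_Collect_eq indicator_Ioo_measurable)
qed

lemma L2_inner_indicator:
  assumes "f \<in> L2 T" "(f has_integral I) {p..q}" "0 \<le> p" "q \<le> T"
  shows "L2_inner T f (indicator {p<..<q}) = I"
  unfolding L2_inner_def
proof (rule integral_lebesgue_on_Ioo)
  show "integrable (lebesgue_on {0<..<T}) (\<lambda>t. f t * indicator {p<..<q} t)"
    by (intro L2_mult_integrable assms indicator_L2)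
  have "((\<lambda>t. if t \<in> {p..q} then f t else 0) has_integral I) {0..T}"
    using assms(2) by (rule has_integral_on_superset[where T = "{0..T}", OF has_integral_restrict[THEN iffD2, rotated]])
      (use assms in auto)
  then show "((\<lambda>t. f t * indicator {p<..<q} t) has_integral I) {0..T}"
    by (rule has_integral_spike[where S = "{p, q}", rotated 2]) (auto simp: indicator_def)
qed

lemma L2_inner_commute: "L2_inner T f g = L2_inner T g f"
  by (simp add: L2_inner_def mult.commute)

lemma L2_inner_sum_left:
  assumes "\<And>i. i \<in> A \<Longrightarrow> f i \<in> L2 T" "g \<in> L2 T"
  shows "L2_inner T (\<lambda>t. \<Sum>i\<in>A. c i * f i t) g = (\<Sum>i\<in>A. c i * L2_inner T (f i) g)"
  using L2_mult_integrable[OF assms]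
  by (simp add: L2_inner_def sum_distrib_right mult.assoc)

section \<open>Elements of the energy space and bounds for the dual norm\<close>

lemma weak_deriv_is_weak_deriv: "q \<in> H1_0T T \<Longrightarrow> is_weak_deriv T q (weak_deriv T q)"
  using someI_ex[of "is_weak_deriv T q"] by (simp add: weak_deriv_def H1_0T_def)

lemma test_function_boundary:
  assumes "\<phi> \<in> test_functions T"
  shows "\<phi> 0 = 0" "\<phi> T = 0"
  using assms closure_subset[of "{t. \<phi> t \<noteq> 0}"] by (auto simp: test_functions_def)

text \<open>Supplies a nonzero element of the space, so that the supremum in
  \<open>dual_norm\<close> is taken over a nonempty set.\<close>

lemma linear_in_H1_0T:
  assumes "T > 0"
  shows "(\<lambda>t. T - t) \<in> H1_0T T"
proof -
  have "is_weak_deriv T (\<lambda>t. T - t) (\<lambda>_. - 1)"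
    unfolding is_weak_deriv_def
  proof (intro conjI ballI)
    show "(\<lambda>t. T - t) \<in> L2 T" "(\<lambda>_. - 1) \<in> L2 T"
      by (intro continuous_L2 continuous_intros)+
    fix \<phi>
    assume \<phi>: "\<phi> \<in> test_functions T"
    then have diff: "(deriv ^^ k) \<phi> differentiable (at t)" for k t
      by (simp add: test_functions_def)
    have \<phi>': "(\<phi> has_real_derivative deriv \<phi> t) (at t)" for t
      using diff[of 0 t] by (auto simp: real_differentiable_def DERIV_imp_deriv)
    have cont: "isCont \<phi> t" "isCont (deriv \<phi>) t" for t
      using diff[of 0 t] diff[of 1 t] by (auto intro: differentiable_imp_continuous_within)
    have L2: "\<phi> \<in> L2 T" "deriv \<phi> \<in> L2 T" "(\<lambda>t. T - t) \<in> L2 T"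
      by (intro continuous_L2 cont continuous_intros)+
    \<comment> \<open>The product rule for (T - t) \<phi>; the boundary terms vanish because \<phi>
      is 0 at both ends.\<close>
    have "((\<lambda>t. (T - t) * deriv \<phi> t - \<phi> t) has_integral (T - T) * \<phi> T - (T - 0) * \<phi> 0) {0..T}"
    proof (rule antiderivative_has_integral)
      show "((\<lambda>t. (T - t) * \<phi> t) has_real_derivative (T - t) * deriv \<phi> t - \<phi> t) (at t)" for t
        by (auto intro!: derivative_eq_intros \<phi>')
    qed (use assms in simp)
    then have "integral\<^sup>L (lebesgue_on {0<..<T}) (\<lambda>t. (T - t) * deriv \<phi> t - \<phi> t) = 0"
      using test_function_boundary[OF \<phi>] L2_mult_integrable[OF L2(3,2)] L2_integrable[OF L2(1)]
      by (intro integral_lebesgue_on_Ioo) auto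
    then show "L2_inner T (\<lambda>t. T - t) (deriv \<phi>) = - L2_inner T (\<lambda>_. - 1) \<phi>"
      using L2_mult_integrable[OF L2(3,2)] L2_integrable[OF L2(1)] by (simp add: L2_inner_def)
  qed
  then show ?thesis
    by (auto simp: H1_0T_def intro!: continuous_intros)
qed

text \<open>A bound on all quotients passes to the supremum over a nonempty set. Bounding the
  absolute value allows the dual norm to be squared later.\<close>

lemma abs_dual_norm_le:
  assumes "T > 0" "\<And>v. v \<in> H1_Sigma T \<Longrightarrow> \<bar>F v\<bar> \<le> K * H1_norm T v" "0 \<le> K"
  shows "\<bar>dual_norm T F\<bar> \<le> K"
  unfolding dual_norm_def
proof (rule cSup_abs_le)
  let ?v = "(\<lambda>t. T - t, \<lambda>t. T - t)"
  have "?v \<in> H1_Sigma T"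
    using linear_in_H1_0T[OF assms(1)] by (simp add: H1_Sigma_def)
  moreover have "\<exists>t\<in>{0..T}. fst ?v t \<noteq> 0 \<or> snd ?v t \<noteq> 0"
    using assms(1) by (intro bexI[of _ 0]) auto
  ultimately show "{F v / H1_norm T v | v. v \<in> H1_Sigma T \<and>
      (\<exists>t\<in>{0..T}. fst v t \<noteq> 0 \<or> snd v t \<noteq> 0)} \<noteq> {}"
    by blast
  fix x
  assume "x \<in> {F v / H1_norm T v | v. v \<in> H1_Sigma T \<and>
      (\<exists>t\<in>{0..T}. fst v t \<noteq> 0 \<or> snd v t \<noteq> 0)}"
  then obtain v where v: "v \<in> H1_Sigma T" and x: "x = F v / H1_norm T v"
    by blast
  have "0 \<le> H1_norm T v"
    by (simp add: H1_norm_def L2_inner_nonneg)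
  then show "\<bar>x\<bar> \<le> K"
    \<comment> \<open>If the norm of v is 0, the quotient is 0 by the convention for division, and K
      \<ge> 0 suffices.\<close>
    using assms(2)[OF v] assms(3) by (cases "H1_norm T v = 0") (auto simp: x field_simps)
qed

section \<open>Piecewise constant functions and their primitives\<close>

text \<open>The components of \<open>pc_fun\<close>, indexed by the side so that one argument serves
  both.\<close>

definition pc_component :: "('l::finite \<Rightarrow> element) \<Rightarrow> real ^ 'l \<Rightarrow> side \<Rightarrow> real \<Rightarrow> real" where
  "pc_component \<tau> w s t = (\<Sum>l | side (\<tau> l) = s. w $ l * indicator {lo (\<tau> l)<..<hi (\<tau> l)} t)"

text \<open>On a mesh, the primitive of \<open>pc_component\<close> that vanishes at 0. As a sum of
  ramps it is continuous on the whole line.\<close>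

definition primitive :: "('l::finite \<Rightarrow> element) \<Rightarrow> real ^ 'l \<Rightarrow> side \<Rightarrow> real \<Rightarrow> real" where
  "primitive \<tau> w s t = (\<Sum>l | side (\<tau> l) = s. w $ l * ramp (lo (\<tau> l)) (hi (\<tau> l)) t)"

lemma pc_fun_eq: "pc_fun \<tau> w = (pc_component \<tau> w At0, pc_component \<tau> w AtL)"
proof -
  have side: "s \<noteq> At0 \<longleftrightarrow> s = AtL" for s
    by (cases s) auto
  show ?thesis
    unfolding pc_fun_def pc_component_def[abs_def] prod.inject
    by (intro conjI ext sum.mono_neutral_cong_right)
      (auto simp: basis_fun_def side split: side.splits)
qed

lemma ramp_isCont: "isCont (ramp a b) t"
  unfolding ramp_def[abs_def] by (intro continuous_intros)

lemma primitive_isCont: "isCont (primitive \<tau> w s) t"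
  unfolding primitive_def[abs_def] by (intro continuous_intros ramp_isCont)

lemma mesh_lo_less_hi: "is_mesh T \<tau> \<Longrightarrow> lo (\<tau> l) < hi (\<tau> l)"
  by (simp add: is_mesh_def)

lemma mesh_bounds:
  assumes "is_mesh T \<tau>"
  shows "0 \<le> lo (\<tau> l)" "hi (\<tau> l) \<le> T"
proof -
  have "{lo (\<tau> l)..hi (\<tau> l)} \<in> {{lo e..hi e} | e. e \<in> range \<tau> \<and> side e = side (\<tau> l)}"
    by blast
  then have "{lo (\<tau> l)..hi (\<tau> l)} \<subseteq> {0..T}"
    using assms division_ofD(2) unfolding is_mesh_def by blast
  then show "0 \<le> lo (\<tau> l)" "hi (\<tau> l) \<le> T"
    using mesh_lo_less_hi[OF assms, of l] by auto
qed

lemma mesh_ordered: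
  assumes "is_mesh T \<tau>" "l \<noteq> l'" "side (\<tau> l) = side (\<tau> l')"
  shows "hi (\<tau> l) \<le> lo (\<tau> l') \<or> hi (\<tau> l') \<le> lo (\<tau> l)"
proof (rule ccontr)
  assume overlap: "\<not> ?thesis"
  note less = mesh_lo_less_hi[OF assms(1), of l] mesh_lo_less_hi[OF assms(1), of l']
  have "\<tau> l \<noteq> \<tau> l'"
    using assms by (auto simp: is_mesh_def inj_eq)
  \<comment> \<open>\<open>division_of\<close> speaks of a set of intervals, so different indices
    must first be seen to give different intervals.\<close>
  then have "{lo (\<tau> l)..hi (\<tau> l)} \<noteq> {lo (\<tau> l')..hi (\<tau> l')}"
    using assms(3) less by (auto simp: Icc_eq_Icc intro: element.expand)
  then have "interior {lo (\<tau> l)..hi (\<tau> l)} \<inter> interior {lo (\<tau> l')..hi (\<tau> l')} = {}"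
    using assms(1,3) unfolding is_mesh_def by (intro division_ofD(5)) blast+
  \<comment> \<open>The midpoint of the overlap is interior to both intervals.\<close>
  moreover have "(max (lo (\<tau> l)) (lo (\<tau> l')) + min (hi (\<tau> l)) (hi (\<tau> l'))) / 2
      \<in> {lo (\<tau> l)<..<hi (\<tau> l)} \<inter> {lo (\<tau> l')<..<hi (\<tau> l')}"
    using overlap less by (auto simp: max_def min_def)
  ultimately show False
    by (simp add: interior_atLeastAtMost_real) 
qed

definition mid :: "element \<Rightarrow> real" where
  "mid e = (lo e + hi e) / 2"

text \<open>On one element only its own ramp varies: the other elements of that side lie entirely
  before or after it, where their ramps are constant.\<close>

lemma primitive_affine:
  assumes "is_mesh T \<tau>" "t \<in> {lo (\<tau> l)..hi (\<tau> l)}"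
  shows "primitive \<tau> w (side (\<tau> l)) t = primitive \<tau> w (side (\<tau> l)) (mid (\<tau> l)) + w $ l * (t - mid (\<tau> l))"
proof -
  have eq: "ramp (lo (\<tau> l')) (hi (\<tau> l')) t - ramp (lo (\<tau> l')) (hi (\<tau> l')) (mid (\<tau> l)) =
      (if l' = l then t - mid (\<tau> l) else 0)" if "side (\<tau> l') = side (\<tau> l)" for l'
  proof (cases "l' = l")
    case True
    then show ?thesis
      using assms(2) by (simp add: ramp_def mid_def max_def min_def field_simps)
  next
    case False
    then show ?thesis
      using mesh_ordered[OF assms(1) False that] assms(2) mesh_lo_less_hi[OF assms(1), of l]
        mesh_lo_less_hi[OF assms(1), of l']
      by (auto simp: ramp_def mid_def max_def min_def)
  qed
  have "primitive \<tau> w (side (\<tau> l)) t - primitive \<tau> w (side (\<tau> l)) (mid (\<tau> l)) =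
      (\<Sum>l' | side (\<tau> l') = side (\<tau> l). w $ l' *
        (ramp (lo (\<tau> l')) (hi (\<tau> l')) t - ramp (lo (\<tau> l')) (hi (\<tau> l')) (mid (\<tau> l))))"
    by (simp add: primitive_def sum_subtractf right_diff_distrib)
  also have "\<dots> = (\<Sum>l' | side (\<tau> l') = side (\<tau> l). if l' = l then w $ l * (t - mid (\<tau> l)) else 0)"
    by (intro sum.cong refl) (auto simp: eq)
  also have "\<dots> = w $ l * (t - mid (\<tau> l))"
    by simp
  finally show ?thesis
    by simp
qed

text \<open>Integration by parts has no boundary terms, since the primitive vanishes at 0 and q at
  T; it follows from the case of a single indicator by linearity.\<close>

lemma L2_inner_pc_component:
  assumes "is_mesh T \<tau>" "T > 0" "q \<in> H1_0T T" "is_weak_deriv T q g"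
  shows "L2_inner T (pc_component \<tau> w s) q = - L2_inner T (primitive \<tau> w s) g"
proof -
  have L2: "q \<in> L2 T" "g \<in> L2 T"
    using assms(4) by (auto simp: is_weak_deriv_def)
  have "L2_inner T (indicator {lo (\<tau> l)<..<hi (\<tau> l)}) q =
      - L2_inner T (ramp (lo (\<tau> l)) (hi (\<tau> l))) g" for l
    using L2_inner_indicator_eq_ramp[OF assms(2-4) mesh_bounds(1)[OF assms(1)]
        mesh_lo_less_hi[OF assms(1)] mesh_bounds(2)[OF assms(1)], of l]
    by (simp add: L2_inner_commute[of T "indicator _"] L2_inner_commute[of T "ramp _ _"])
  then show ?thesis
    unfolding pc_component_def[abs_def] primitive_def[abs_def]
    by (simp add: L2_inner_sum_left indicator_L2 continuous_L2 ramp_isCont L2 sum_negf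
        del: sum_mult_indicator)
qed

lemma abs_dual_norm_pc_fun_le:
  assumes "is_mesh T \<tau>" "T > 0"
  shows "\<bar>dual_norm T (L2_inner_Sigma T (pc_fun \<tau> w))\<bar> \<le>
    sqrt (L2_inner T (primitive \<tau> w At0) (primitive \<tau> w At0) +
          L2_inner T (primitive \<tau> w AtL) (primitive \<tau> w AtL))"
  (is "_ \<le> sqrt (?A + ?B)")
proof (rule abs_dual_norm_le[OF assms(2)])
  fix v
  assume "v \<in> H1_Sigma T"
  then have v: "fst v \<in> H1_0T T" "snd v \<in> H1_0T T"
    by (auto simp: H1_Sigma_def)
  let ?g = "weak_deriv T (fst v)" and ?h = "weak_deriv T (snd v)"
  let ?C = "L2_inner T ?g ?g" and ?D = "L2_inner T ?h ?h"
  note wd = v[THEN weak_deriv_is_weak_deriv]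
  then have L2: "?g \<in> L2 T" "?h \<in> L2 T"
    by (auto simp: is_weak_deriv_def)
  have "\<bar>L2_inner_Sigma T (pc_fun \<tau> w) v\<bar> =
      \<bar>L2_inner T (primitive \<tau> w At0) ?g + L2_inner T (primitive \<tau> w AtL) ?h\<bar>"
    using L2_inner_pc_component[OF assms v(1) wd(1)] L2_inner_pc_component[OF assms v(2) wd(2)]
    by (simp add: L2_inner_Sigma_def pc_fun_eq)
  also have "\<dots> \<le> sqrt ?A * sqrt ?C + sqrt ?B * sqrt ?D"
    by (intro order_trans[OF abs_triangle_ineq] add_mono L2_Cauchy_Schwarz continuous_L2
        primitive_isCont L2)
  \<comment> \<open>Cauchy-Schwarz in the plane, with the norms on the two sides as
    coordinates.\<close>
  also have "\<dots> \<le> \<bar>(sqrt ?A, sqrt ?B) \<bullet> (sqrt ?C, sqrt ?D)\<bar>"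
    by simp
  also have "\<dots> \<le> norm (sqrt ?A, sqrt ?B) * norm (sqrt ?C, sqrt ?D)"
    by (rule Cauchy_Schwarz_ineq2)
  also have "\<dots> = sqrt (?A + ?B) * H1_norm T v"
    by (simp add: norm_prod_def H1_norm_def L2_inner_nonneg)
  finally show "\<bar>L2_inner_Sigma T (pc_fun \<tau> w) v\<bar> \<le> sqrt (?A + ?B) * H1_norm T v" .
qed (simp add: L2_inner_nonneg)

section \<open>Exact integrals and midpoint sums of affine functions and their squares\<close>

text \<open>Expanding about the midpoint makes the mixed term integrate to 0.\<close>

lemma square_affine_has_integral:
  fixes a b \<alpha> \<beta> :: real
  assumes "a \<le> b"
  shows "((\<lambda>t. (\<alpha> + \<beta> * (t - (a + b) / 2))\<^sup>2) has_integral
    (b - a) * \<alpha>\<^sup>2 + \<beta>\<^sup>2 * (b - a) ^ 3 / 12) {a..b}"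
proof -
  let ?F = "\<lambda>t. \<alpha>\<^sup>2 * t + \<alpha> * \<beta> * (t - (a + b) / 2)\<^sup>2 + \<beta>\<^sup>2 * (t - (a + b) / 2) ^ 3 / 3"
  have "((\<lambda>t. (\<alpha> + \<beta> * (t - (a + b) / 2))\<^sup>2) has_integral ?F b - ?F a) {a..b}"
  proof (rule antiderivative_has_integral[OF _ assms])
    show "(?F has_real_derivative (\<alpha> + \<beta> * (t - (a + b) / 2))\<^sup>2) (at t)" for t
      by (rule derivative_eq_intros refl | simp)+ (simp add: power2_eq_square algebra_simps)
  qed
  also have "?F b - ?F a = (b - a) * \<alpha>\<^sup>2 + \<beta>\<^sup>2 * (b - a) ^ 3 / 12"
    by (simp add: power2_eq_square power3_eq_cube field_simps)
  finally show ?thesis .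
qed

text \<open>The centre c is free because it will be the midpoint of a coarse element while the
  integral runs over a fine one.\<close>

lemma affine_has_integral:
  fixes a b \<alpha> \<beta> c :: real
  assumes "a \<le> b"
  shows "((\<lambda>t. \<alpha> + \<beta> * (t - c)) has_integral (b - a) * (\<alpha> + \<beta> * ((a + b) / 2 - c))) {a..b}"
proof -
  let ?F = "\<lambda>t. \<alpha> * t + \<beta> * (t - c)\<^sup>2 / 2"
  have "((\<lambda>t. \<alpha> + \<beta> * (t - c)) has_integral ?F b - ?F a) {a..b}"
  proof (rule antiderivative_has_integral[OF _ assms])
    show "(?F has_real_derivative \<alpha> + \<beta> * (t - c)) (at t)" for t
      by (rule derivative_eq_intros refl | simp)+
  qed
  also have "?F b - ?F a = (b - a) * (\<alpha> + \<beta> * ((a + b) / 2 - c))"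
    by (simp add: power2_eq_square field_simps)
  finally show ?thesis .
qed

text \<open>The values at the m midpoints form an arithmetic progression with mean \<alpha>, so the
  sum is d times the squared mean plus d times the variance.\<close>

lemma sum_midpoint_squares:
  fixes d \<alpha> \<beta> :: real
  assumes "m > 0"
  shows "(\<Sum>i<m. d / real m * (\<alpha> + \<beta> * ((real i + 1 / 2) * d / real m - d / 2))\<^sup>2) =
    d * \<alpha>\<^sup>2 + (1 - 1 / (real m)\<^sup>2) * (\<beta>\<^sup>2 * d ^ 3 / 12)"
proof -
  define M where "M = real m"
  have M: "M > 0"
    using assms by (simp add: M_def)
  have s1: "(\<Sum>i<n. real i) = real n * (real n - 1) / 2" for n
    by (induction n) (auto simp: field_simps)
  have s2: "(\<Sum>i<n. (real i)\<^sup>2) = real n * (real n - 1) * (2 * real n - 1) / 6" for n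
    by (induction n) (auto simp: power2_eq_square field_simps)
  \<comment> \<open>\<open>k\<close> is the increment between neighbouring midpoints,
    \<open>A\<close> the value at the first one.\<close>
  define k where "k = \<beta> * d / M"
  define A where "A = \<alpha> - k * (M - 1) / 2"
  have "(\<Sum>i<m. d / M * (\<alpha> + \<beta> * ((real i + 1 / 2) * d / M - d / 2))\<^sup>2) =
      (\<Sum>i<m. d / M * (A\<^sup>2 + 2 * A * k * real i + k\<^sup>2 * (real i)\<^sup>2))"
  proof (intro sum.cong refl)
    fix i
    have "\<alpha> + \<beta> * ((real i + 1 / 2) * d / M - d / 2) = A + k * real i"
      using M by (simp add: A_def k_def field_simps)
    then show "d / M * (\<alpha> + \<beta> * ((real i + 1 / 2) * d / M - d / 2))\<^sup>2 =
        d / M * (A\<^sup>2 + 2 * A * k * real i + k\<^sup>2 * (real i)\<^sup>2)"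
      by (simp add: power2_sum power_mult_distrib)
  qed
  also have "\<dots> = d / M * (\<Sum>i<m. A\<^sup>2 + 2 * A * k * real i + k\<^sup>2 * (real i)\<^sup>2)"
    by (rule sum_distrib_left[symmetric])
  also have "(\<Sum>i<m. A\<^sup>2 + 2 * A * k * real i + k\<^sup>2 * (real i)\<^sup>2) =
      M * A\<^sup>2 + 2 * A * k * (M * (M - 1) / 2) + k\<^sup>2 * (M * (M - 1) * (2 * M - 1) / 6)"
    by (simp only: sum.distrib sum_distrib_left[symmetric] s1 s2 sum_constant card_lessThan M_def)
  \<comment> \<open>The variance of M equally spaced values is k^2 (M^2 - 1) / 12; this is the
    source of the factor 1 - 1 / M^2.\<close>
  also have "\<dots> = M * (\<alpha>\<^sup>2 + k\<^sup>2 * (M\<^sup>2 - 1) / 12)"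
    by (simp add: A_def power2_eq_square field_simps)
  also have "d / M * \<dots> = d * \<alpha>\<^sup>2 + d * (k\<^sup>2 * (M\<^sup>2 - 1) / 12)"
    using M by (simp add: distrib_left)
  also have "k\<^sup>2 * (M\<^sup>2 - 1) = (\<beta> * d)\<^sup>2 * (1 - 1 / M\<^sup>2)"
    using M by (simp add: k_def power_divide diff_divide_distrib right_diff_distrib)
  also have "d * ((\<beta> * d)\<^sup>2 * (1 - 1 / M\<^sup>2) / 12) = (1 - 1 / M\<^sup>2) * (\<beta>\<^sup>2 * d ^ 3 / 12)"
    by (simp add: power2_eq_square power3_eq_cube)
  finally show ?thesis
    by (simp add: M_def)
qed

abbreviation len :: "element \<Rightarrow> real" where
  "len e \<equiv> hi e - lo e"

text \<open>The integral splits over the elements, and on each the primitive is affine.\<close>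

lemma L2_norm_primitive:
  assumes "is_mesh T \<tau>"
  shows "L2_inner T (primitive \<tau> w s) (primitive \<tau> w s) =
    (\<Sum>l | side (\<tau> l) = s. len (\<tau> l) * (primitive \<tau> w s (mid (\<tau> l)))\<^sup>2 +
       (w $ l)\<^sup>2 * len (\<tau> l) ^ 3 / 12)"
proof -
  let ?f = "\<lambda>t. (primitive \<tau> w s t)\<^sup>2"
  let ?I = "\<lambda>l. {lo (\<tau> l)..hi (\<tau> l)}"
  have D: "{{lo e..hi e} | e. e \<in> range \<tau> \<and> side e = s} = ?I ` {l. side (\<tau> l) = s}"
    by auto
  \<comment> \<open>Needed to turn the sum over the set of intervals into a sum over
    indices.\<close>
  have inj: "inj_on ?I {l. side (\<tau> l) = s}"
  proof (rule inj_onI)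
    fix l l'
    assume "l \<in> {l. side (\<tau> l) = s}" "l' \<in> {l. side (\<tau> l) = s}" "?I l = ?I l'"
    then have "\<tau> l = \<tau> l'"
      using mesh_lo_less_hi[OF assms, of l] by (auto simp: Icc_eq_Icc intro: element.expand)
    then show "l = l'"
      using assms by (auto simp: is_mesh_def inj_eq)
  qed
  have "?f integrable_on {0..T}"
    by (intro integrable_continuous_real continuous_intros continuous_at_imp_continuous_on ballI primitive_isCont)
  then have "integral {0..T} ?f = (\<Sum>K\<in>?I ` {l. side (\<tau> l) = s}. integral K ?f)"
    using assms unfolding is_mesh_def D[symmetric] by (intro integral_combine_division_topdown) auto
  also have "\<dots> = (\<Sum>l | side (\<tau> l) = s. integral (?I l) ?f)"
    by (rule sum.reindex_cong[OF inj]) auto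
  also have "\<dots> = (\<Sum>l | side (\<tau> l) = s. len (\<tau> l) * (primitive \<tau> w s (mid (\<tau> l)))\<^sup>2 +
       (w $ l)\<^sup>2 * len (\<tau> l) ^ 3 / 12)"
  proof (intro sum.cong refl integral_unique)
    fix l
    assume "l \<in> {l. side (\<tau> l) = s}"
    then have s: "s = side (\<tau> l)"
      by simp
    show "(?f has_integral len (\<tau> l) * (primitive \<tau> w s (mid (\<tau> l)))\<^sup>2 +
       (w $ l)\<^sup>2 * len (\<tau> l) ^ 3 / 12) (?I l)"
    proof (rule has_integral_eq)
      show "((\<lambda>t. (primitive \<tau> w s (mid (\<tau> l)) + w $ l * (t - mid (\<tau> l)))\<^sup>2) has_integral
          len (\<tau> l) * (primitive \<tau> w s (mid (\<tau> l)))\<^sup>2 + (w $ l)\<^sup>2 * len (\<tau> l) ^ 3 / 12) (?I l)"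
        unfolding mid_def
        by (rule square_affine_has_integral) (simp add: less_imp_le mesh_lo_less_hi[OF assms])
      show "(primitive \<tau> w s (mid (\<tau> l)) + w $ l * (t - mid (\<tau> l)))\<^sup>2 = ?f t" if "t \<in> ?I l" for t
        using primitive_affine[OF assms that, of w] by (simp add: s)
    qed
  qed
  finally show ?thesis
    by (simp add: L2_inner_continuous primitive_isCont)
qed

section \<open>The Schur complement\<close>

text \<open>For L = T the delayed integrals range over empty intervals whenever t < T, so the
  operator is half the primitive on each side and the sides decouple.\<close>

lemma single_layer_inner:
  assumes "is_mesh T \<tau>" "T > 0"
  shows "L2_inner_Sigma T (single_layer T (basis_fun (\<tau> l))) (basis_fun e) =
    (if side (\<tau> l) = side e
     then L2_inner T (ramp (lo (\<tau> l)) (hi (\<tau> l))) (indicator {lo e<..<hi e}) / 2 else 0)"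
proof -
  have ind: "integral\<^sup>L (lebesgue_on {0<..<t}) (indicator {lo (\<tau> l)<..<hi (\<tau> l)}) =
      ramp (lo (\<tau> l)) (hi (\<tau> l)) t" for t
    using mesh_bounds(1)[OF assms(1), of l] mesh_lo_less_hi[OF assms(1), of l]
    by (intro integral_lebesgue_on_Ioo L2_integrable indicator_L2 indicator_has_integral_ramp) auto
  have empty: "integral\<^sup>L (lebesgue_on {0<..<t - T}) f = 0" if "t \<in> {0<..<T}" for t and f :: "real \<Rightarrow> real"
    using that by (simp add: lebesgue_on_UNIV_eq integral_restrict_space)
  \<comment> \<open>The inner product sees only values on (0, T), and only there do the delayed
    terms vanish.\<close>
  have eq: "L2_inner T f h = L2_inner T g h" if "\<And>t. t \<in> {0<..<T} \<Longrightarrow> f t = g t" for f g h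
    unfolding L2_inner_def using that by (intro Bochner_Integration.integral_cong) auto
  have scale: "L2_inner T (\<lambda>t. f t / 2) h = L2_inner T f h / 2" for f h
    by (simp add: L2_inner_def)
  have zero: "L2_inner T (\<lambda>t. 0) h = 0" "L2_inner T h (\<lambda>t. 0) = 0" for h
    by (simp_all add: L2_inner_def)
  let ?v = "single_layer T (basis_fun (\<tau> l))" and ?r = "ramp (lo (\<tau> l)) (hi (\<tau> l))"
  have "fst ?v t = (if side (\<tau> l) = At0 then ?r t / 2 else 0) \<and>
      snd ?v t = (if side (\<tau> l) = AtL then ?r t / 2 else 0)" if "t \<in> {0<..<T}" for t
    by (cases "side (\<tau> l)")
      (simp_all only: single_layer_def basis_fun_def fst_conv snd_conv side.case ind[of t] empty[OF that]
        Bochner_Integration.integral_zero side.distinct if_True if_False, simp_all)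
  then have "L2_inner T (fst ?v) h = L2_inner T (\<lambda>t. if side (\<tau> l) = At0 then ?r t / 2 else 0) h"
       "L2_inner T (snd ?v) h = L2_inner T (\<lambda>t. if side (\<tau> l) = AtL then ?r t / 2 else 0) h" for h
    by (intro eq; simp)+
  then have "L2_inner T (fst ?v) h = (if side (\<tau> l) = At0 then L2_inner T ?r h / 2 else 0)"
       "L2_inner T (snd ?v) h = (if side (\<tau> l) = AtL then L2_inner T ?r h / 2 else 0)" for h
    by (simp_all add: scale zero)
  then show ?thesis
    by (cases "side (\<tau> l)"; cases "side e") (simp_all add: L2_inner_Sigma_def basis_fun_def zero)
qed

lemma V_mat_mult:
  assumes "is_mesh T \<tau>" "T > 0"
  shows "(V_mat T T \<tau> \<sigma> *v w) $ j =
    L2_inner T (primitive \<tau> w (side (\<sigma> j))) (indicator {lo (\<sigma> j)<..<hi (\<sigma> j)}) / 2"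
proof -
  have "(V_mat T T \<tau> \<sigma> *v w) $ j = (\<Sum>l\<in>UNIV. (if side (\<tau> l) = side (\<sigma> j)
     then L2_inner T (ramp (lo (\<tau> l)) (hi (\<tau> l))) (indicator {lo (\<sigma> j)<..<hi (\<sigma> j)}) / 2 else 0) * w $ l)"
    by (simp add: matrix_vector_mult_def V_mat_def single_layer_inner[OF assms])
  also have "\<dots> = (\<Sum>l | side (\<tau> l) = side (\<sigma> j).
     w $ l * L2_inner T (ramp (lo (\<tau> l)) (hi (\<tau> l))) (indicator {lo (\<sigma> j)<..<hi (\<sigma> j)})) / 2"
    unfolding sum_divide_distrib by (intro sum.mono_neutral_cong_right) auto
  also have "\<dots> = L2_inner T (primitive \<tau> w (side (\<sigma> j))) (indicator {lo (\<sigma> j)<..<hi (\<sigma> j)}) / 2"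
    unfolding primitive_def[abs_def]
    by (simp add: L2_inner_sum_left indicator_L2 continuous_L2 ramp_isCont)
  finally show ?thesis .
qed

section \<open>Geometry of the refined mesh\<close>

text \<open>The members of \<open>subdivide\<close> numbered by position, for sums over the pieces
  of a coarse element.\<close>

definition sub_element :: "nat \<Rightarrow> element \<Rightarrow> nat \<Rightarrow> element" where
  "sub_element m e i = Element (side e) (lo e + real i * (hi e - lo e) / real m)
                                (lo e + real (Suc i) * (hi e - lo e) / real m)"

lemma subdivide_eq: "subdivide m e = sub_element m e ` {..<m}"
  by (simp add: subdivide_def sub_element_def)

lemma sub_element_sel [simp]:
  "side (sub_element m e i) = side e"
  "lo (sub_element m e i) = lo e + real i * len e / real m"
  "hi (sub_element m e i) = lo e + real (Suc i) * len e / real m"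
  by (simp_all add: sub_element_def)

lemma sub_element_bounds:
  assumes "lo e < hi e" "i < m"
  shows "lo e \<le> lo (sub_element m e i)" "hi (sub_element m e i) \<le> hi e"
    and "lo (sub_element m e i) < hi (sub_element m e i)"
proof -
  have "real (Suc i) / real m \<le> 1"
    using assms(2) by simp
  then have "real (Suc i) / real m * len e \<le> 1 * len e"
    using assms(1) by (intro mult_right_mono) auto
  then show "hi (sub_element m e i) \<le> hi e"
    by simp
qed (use assms in \<open>simp_all add: divide_strict_right_mono\<close>)

lemma sub_element_ordered:
  assumes "lo e < hi e" "i < i'" "i' < m"
  shows "hi (sub_element m e i) \<le> lo (sub_element m e i')"
proof -
  have "real (Suc i) \<le> real i'"
    using assms(2) by simp
  then show ?thesis
    using assms(1) by (simp only: sub_element_sel) (intro add_left_mono divide_right_mono mult_right_mono, auto)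
qed

text \<open>The form of the offset is that of the summand in
  \<open>sum_midpoint_squares\<close>.\<close>

lemma mid_sub_element:
  "mid (sub_element m e i) - mid e = (real i + 1 / 2) * len e / real m - len e / 2"
  by (simp add: mid_def add_divide_distrib diff_divide_distrib distrib_right)

lemma len_sub_element: "len (sub_element m e i) = len e / real m"
  by (simp add: add_divide_distrib distrib_right)

lemma refinement_cases:
  assumes "is_uniform_refinement m \<tau> \<sigma>"
  obtains l i where "i < m" "\<sigma> j = sub_element m (\<tau> l) i"
proof -
  have "\<sigma> j \<in> (\<Union>l. subdivide m (\<tau> l))"
    using assms by (auto simp: is_uniform_refinement_def)
  then show thesis
    using that by (auto simp: subdivide_eq)
qed

lemma refinement_lo_less_hi:
  assumes "is_mesh T \<tau>" "is_uniform_refinement m \<tau> \<sigma>"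
  shows "lo (\<sigma> j) < hi (\<sigma> j)"
  using refinement_cases[OF assms(2), of j] sub_element_bounds(3) mesh_lo_less_hi[OF assms(1)] by metis

lemma refinement_bounds:
  assumes "is_mesh T \<tau>" "is_uniform_refinement m \<tau> \<sigma>"
  shows "0 \<le> lo (\<sigma> j)" "hi (\<sigma> j) \<le> T"
  using refinement_cases[OF assms(2), of j] sub_element_bounds(1,2) mesh_lo_less_hi[OF assms(1)]
    mesh_bounds[OF assms(1)] by (metis order_trans)+

text \<open>Pieces of one coarse element are ordered by position; pieces of different ones inherit
  the order of their parents.\<close>

lemma refinement_ordered:
  assumes "is_mesh T \<tau>" "is_uniform_refinement m \<tau> \<sigma>" "j \<noteq> k" "side (\<sigma> j) = side (\<sigma> k)"
  shows "hi (\<sigma> j) \<le> lo (\<sigma> k) \<or> hi (\<sigma> k) \<le> lo (\<sigma> j)"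
proof -
  obtain l i where j: "i < m" "\<sigma> j = sub_element m (\<tau> l) i"
    using assms(2) by (rule refinement_cases)
  obtain l' i' where k: "i' < m" "\<sigma> k = sub_element m (\<tau> l') i'"
    using assms(2) by (rule refinement_cases)
  note less = mesh_lo_less_hi[OF assms(1), of l] mesh_lo_less_hi[OF assms(1), of l']
  show ?thesis
  proof (cases "l = l'")
    case True
    have "\<sigma> j \<noteq> \<sigma> k"
      using assms(2,3) by (auto simp: is_uniform_refinement_def inj_eq)
    then have "i \<noteq> i'"
      using True j k by auto
    then have "i < i' \<or> i' < i"
      by (simp add: neq_iff)
    then show ?thesis
      using sub_element_ordered[OF less(1)] True j k by metis
  next
    case False
    then have "hi (\<tau> l) \<le> lo (\<tau> l') \<or> hi (\<tau> l') \<le> lo (\<tau> l)"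
      using mesh_ordered[OF assms(1)] assms(4) j k by simp
    then show ?thesis
      using sub_element_bounds(1,2)[OF less(1) j(1)] sub_element_bounds(1,2)[OF less(2) k(1)] j(2) k(2)
      by (metis order_trans)
  qed
qed

text \<open>Replaces the arbitrary numbering of the fine mesh by pairs of a coarse element and a
  position. No piece is counted twice: left endpoints separate positions, and ordered parents share
  no piece of positive length.\<close>

lemma sum_refinement:
  assumes "is_mesh T \<tau>" "is_uniform_refinement m \<tau> \<sigma>"
  shows "(\<Sum>j\<in>UNIV. G (\<sigma> j)) = (\<Sum>l\<in>UNIV. \<Sum>i<m. G (sub_element m (\<tau> l) i))"
proof -
  have inj: "inj_on (sub_element m (\<tau> l)) {..<m}" for l
  proof (rule inj_onI)
    fix i i'
    assume "i \<in> {..<m}" "i' \<in> {..<m}" and eq: "sub_element m (\<tau> l) i = sub_element m (\<tau> l) i'"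
    from arg_cong[OF eq, of lo] show "i = i'"
      using \<open>i \<in> {..<m}\<close> mesh_lo_less_hi[OF assms(1), of l] by auto
  qed
  have disj: "subdivide m (\<tau> l) \<inter> subdivide m (\<tau> l') = {}" if "l \<noteq> l'" for l l'
  proof (rule ccontr)
    assume "subdivide m (\<tau> l) \<inter> subdivide m (\<tau> l') \<noteq> {}"
    then obtain i i' where i: "i < m" "i' < m" "sub_element m (\<tau> l) i = sub_element m (\<tau> l') i'"
      by (auto simp: subdivide_eq)
    then have "side (\<tau> l) = side (\<tau> l')"
      by (metis sub_element_sel(1))
    then have "hi (\<tau> l) \<le> lo (\<tau> l') \<or> hi (\<tau> l') \<le> lo (\<tau> l)"
      using mesh_ordered[OF assms(1) that] by simp
    then show False
      using sub_element_bounds[OF mesh_lo_less_hi[OF assms(1)] i(1), of l]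
        sub_element_bounds(1,2)[OF mesh_lo_less_hi[OF assms(1)] i(2), of l', folded i(3)]
      by linarith
  qed
  have "(\<Sum>j\<in>UNIV. G (\<sigma> j)) = sum G (range \<sigma>)"
    using assms(2) sum.reindex[of \<sigma> UNIV G] by (simp add: is_uniform_refinement_def)
  also have "\<dots> = (\<Sum>l\<in>UNIV. sum G (subdivide m (\<tau> l)))"
    using assms(2) disj unfolding is_uniform_refinement_def
    by (simp add: sum.UNION_disjoint subdivide_eq)
  also have "\<dots> = (\<Sum>l\<in>UNIV. \<Sum>i<m. G (sub_element m (\<tau> l) i))"
    by (simp add: subdivide_eq sum.reindex[OF inj])
  finally show ?thesis .
qed

section \<open>The diagonal mass matrix and the quadratic form\<close>

lemma D_mat_eq:
  assumes "is_mesh T \<tau>" "is_uniform_refinement m \<tau> \<sigma>"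
  shows "D_mat T \<sigma> = (\<chi> j k. if j = k then len (\<sigma> j) else 0)"
proof -
  have "L2_inner_Sigma T (basis_fun (\<sigma> k)) (basis_fun (\<sigma> j)) = (if j = k then len (\<sigma> j) else 0)" for j k
  proof -
    let ?f = "indicator {lo (\<sigma> k)<..<hi (\<sigma> k)} :: real \<Rightarrow> real"
    let ?g = "indicator {lo (\<sigma> j)<..<hi (\<sigma> j)} :: real \<Rightarrow> real"
    have "L2_inner_Sigma T (basis_fun (\<sigma> k)) (basis_fun (\<sigma> j)) =
        (if side (\<sigma> j) = side (\<sigma> k) then L2_inner T ?f ?g else 0)"
      by (cases "side (\<sigma> j)"; cases "side (\<sigma> k)")
        (simp_all add: L2_inner_Sigma_def L2_inner_def basis_fun_def)
    moreover have "L2_inner T ?f ?g = len (\<sigma> j)" if "j = k"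
    proof (rule L2_inner_indicator)
      have "((\<lambda>_. 1) has_integral len (\<sigma> j)) {lo (\<sigma> j)..hi (\<sigma> j)}"
        using has_integral_const_real[of "1::real" "lo (\<sigma> j)" "hi (\<sigma> j)"]
          refinement_lo_less_hi[OF assms, of j] by simp
      then show "(?f has_integral len (\<sigma> j)) {lo (\<sigma> j)..hi (\<sigma> j)}"
        by (rule has_integral_spike[where S = "{lo (\<sigma> j), hi (\<sigma> j)}", rotated 2])
          (auto simp: indicator_def that)
    qed (use refinement_bounds[OF assms] indicator_L2 in auto)
    moreover have "L2_inner T ?f ?g = 0" if "j \<noteq> k" "side (\<sigma> j) = side (\<sigma> k)"
    proof -
      have "?f t * ?g t = 0" for t
        using refinement_ordered[OF assms that] by (auto simp: indicator_def)
      then show ?thesis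
        by (simp only: L2_inner_def) simp
    qed
    ultimately show ?thesis
      by auto
  qed
  then show ?thesis
    by (simp add: D_mat_def)
qed

text \<open>\<open>matrix_inv\<close> is defined by choice, so an explicit inverse has to be
  identified with it.\<close>

lemma matrix_inv_unique:
  fixes A :: "real ^ 'n ^ 'm"
  assumes "A ** B = mat 1" "B ** A = mat 1"
  shows "matrix_inv A = B"
proof -
  have "A ** matrix_inv A = mat 1 \<and> matrix_inv A ** A = mat 1"
    unfolding matrix_inv_def by (rule someI[where x = B]) (simp add: assms)
  then have "B ** A ** matrix_inv A = B"
    by (metis matrix_mul_assoc matrix_mul_rid)
  then show ?thesis
    by (simp add: assms(2))
qed

lemma diagonal_vector_mult:
  "((\<chi> j k. if j = k then d j else 0) *v u) $ j = d j * (u $ j :: real)"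
proof -
  have "((\<chi> j k. if j = k then d j else 0) *v u) $ j = (\<Sum>k\<in>UNIV. (if j = k then d j else 0) * u $ k)"
    by (simp add: matrix_vector_mult_def)
  also have "\<dots> = (\<Sum>k\<in>UNIV. if j = k then d j * u $ j else 0)"
    by (intro sum.cong) auto
  finally show ?thesis
    by simp
qed

lemma diagonal_mult:
  fixes a b :: "'k::finite \<Rightarrow> real"
  assumes "\<And>j. a j * b j = 1"
  shows "(\<chi> j k. if j = k then a j else 0) ** (\<chi> j k. if j = k then b j else 0) = mat 1"
proof -
  have "(\<chi> j k. if j = k then a j else 0) *v ((\<chi> j k. if j = k then b j else 0) *v u) = mat 1 *v u" for u
    by (simp add: vec_eq_iff diagonal_vector_mult assms flip: mult.assoc)
  then show ?thesis
    unfolding matrix_eq matrix_vector_mul_assoc by simp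
qed

lemma matrix_inv_diagonal:
  fixes d :: "'k::finite \<Rightarrow> real"
  assumes "\<And>j. d j \<noteq> 0"
  shows "matrix_inv (\<chi> j k. if j = k then d j else 0) = (\<chi> j k. if j = k then 1 / d j else 0)"
  using assms by (intro matrix_inv_unique diagonal_mult) simp_all

text \<open>Moving the transpose to the other side of the inner product leaves the diagonal form of
  the inverse mass matrix at V w.\<close>

lemma schur_mat_quadratic_form:
  assumes "is_mesh T \<tau>" "is_uniform_refinement m \<tau> \<sigma>"
  shows "transpose (schur_mat L T \<tau> \<sigma>) = schur_mat L T \<tau> \<sigma>"
    and "(schur_mat L T \<tau> \<sigma> *v w) \<bullet> w = (\<Sum>j\<in>UNIV. ((V_mat L T \<tau> \<sigma> *v w) $ j)\<^sup>2 / len (\<sigma> j))"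
proof -
  define E :: "real ^ 'b ^ 'b" where "E = (\<chi> j k. if j = k then 1 / len (\<sigma> j) else 0)"
  have inv: "matrix_inv (D_mat T \<sigma>) = E"
    unfolding D_mat_eq[OF assms] E_def
    using refinement_lo_less_hi[OF assms] by (intro matrix_inv_diagonal) (simp add: less_imp_neq[symmetric])
  have "transpose E = E"
    by (auto simp: transpose_def E_def vec_eq_iff)
  then show "transpose (schur_mat L T \<tau> \<sigma>) = schur_mat L T \<tau> \<sigma>"
    by (simp add: schur_mat_def inv matrix_transpose_mul matrix_mul_assoc)
  let ?u = "V_mat L T \<tau> \<sigma> *v w"
  have "(schur_mat L T \<tau> \<sigma> *v w) \<bullet> w = (E *v ?u) \<bullet> ?u"
    by (simp add: schur_mat_def inv matrix_vector_mul_assoc[symmetric] transpose_matrix_vector dot_lmul_matrix)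
  also have "\<dots> = (\<Sum>j\<in>UNIV. (?u $ j)\<^sup>2 / len (\<sigma> j))"
  proof -
    have "(E *v ?u) $ j = ?u $ j / len (\<sigma> j)" for j
      by (simp add: E_def diagonal_vector_mult)
    then show ?thesis
      by (simp add: inner_vec_def power2_eq_square)
  qed
  finally show "(schur_mat L T \<tau> \<sigma> *v w) \<bullet> w = (\<Sum>j\<in>UNIV. (?u $ j)\<^sup>2 / len (\<sigma> j))" .
qed

text \<open>A fine element lies in one coarse element, where the primitive is affine, so its
  integral is length times midpoint value.\<close>

lemma V_mat_mult_refinement:
  assumes "is_mesh T \<tau>" "is_uniform_refinement m \<tau> \<sigma>" "T > 0"
  shows "(V_mat T T \<tau> \<sigma> *v w) $ j = len (\<sigma> j) * primitive \<tau> w (side (\<sigma> j)) (mid (\<sigma> j)) / 2"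
proof -
  obtain l i where j: "i < m" "\<sigma> j = sub_element m (\<tau> l) i"
    using assms(2) by (rule refinement_cases)
  let ?W = "primitive \<tau> w (side (\<tau> l))"
  have sub: "{lo (\<sigma> j)..hi (\<sigma> j)} \<subseteq> {lo (\<tau> l)..hi (\<tau> l)}"
    using sub_element_bounds(1,2)[OF mesh_lo_less_hi[OF assms(1)] j(1), of l] unfolding j(2) by auto
  note affine = primitive_affine[OF assms(1) subsetD[OF sub], of _ w]
  have le: "lo (\<sigma> j) \<le> hi (\<sigma> j)"
    using refinement_lo_less_hi[OF assms(1,2), of j] by simp
  then have "mid (\<sigma> j) \<in> {lo (\<sigma> j)..hi (\<sigma> j)}"
    by (simp add: mid_def)
  note mid = affine[OF this]
  have "(?W has_integral len (\<sigma> j) * ?W (mid (\<sigma> j))) {lo (\<sigma> j)..hi (\<sigma> j)}"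
    unfolding mid
    by (rule has_integral_eq[OF affine[symmetric]])
      (use affine_has_integral[OF le] in \<open>auto simp: mid_def[of "\<sigma> j"]\<close>)
  then have "L2_inner T ?W (indicator {lo (\<sigma> j)<..<hi (\<sigma> j)}) = len (\<sigma> j) * ?W (mid (\<sigma> j))"
    by (intro L2_inner_indicator continuous_L2 primitive_isCont refinement_bounds[OF assms(1,2)])
  then show ?thesis
    using j(2) by (simp add: V_mat_mult[OF assms(1,3)])
qed

text \<open>Squared moments divided by lengths form the midpoint rule on the fine mesh; grouped by
  coarse elements, it is evaluated by \<open>sum_midpoint_squares\<close>.\<close>

lemma schur_mat_eq:
  assumes "is_mesh T \<tau>" "is_uniform_refinement m \<tau> \<sigma>" "T > 0" "m > 0"
  shows "(schur_mat T T \<tau> \<sigma> *v w) \<bullet> w =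
    (\<Sum>l\<in>UNIV. len (\<tau> l) * (primitive \<tau> w (side (\<tau> l)) (mid (\<tau> l)))\<^sup>2 +
       (1 - 1 / (real m)\<^sup>2) * ((w $ l)\<^sup>2 * len (\<tau> l) ^ 3 / 12)) / 4"
proof -
  let ?W = "primitive \<tau> w"
  have "(schur_mat T T \<tau> \<sigma> *v w) \<bullet> w =
      (\<Sum>j\<in>UNIV. len (\<sigma> j) * (?W (side (\<sigma> j)) (mid (\<sigma> j)))\<^sup>2 / 4)"
    unfolding schur_mat_quadratic_form(2)[OF assms(1,2)] V_mat_mult_refinement[OF assms(1-3)]
  proof (intro sum.cong refl)
    have eq: "(x * y / 2)\<^sup>2 / x = x * y\<^sup>2 / 4" if "x \<noteq> 0" for x y :: real
      using that by (simp add: power2_eq_square)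
    show "(len (\<sigma> j) * ?W (side (\<sigma> j)) (mid (\<sigma> j)) / 2)\<^sup>2 / len (\<sigma> j) =
        len (\<sigma> j) * (?W (side (\<sigma> j)) (mid (\<sigma> j)))\<^sup>2 / 4" for j
      using refinement_lo_less_hi[OF assms(1,2), of j] by (intro eq) simp
  qed
  also have "\<dots> = (\<Sum>l\<in>UNIV. \<Sum>i<m. len (sub_element m (\<tau> l) i) *
      (?W (side (sub_element m (\<tau> l) i)) (mid (sub_element m (\<tau> l) i)))\<^sup>2 / 4)"
    using sum_refinement[OF assms(1,2), of "\<lambda>e. len e * (?W (side e) (mid e))\<^sup>2 / 4"] .
  also have "\<dots> = (\<Sum>l\<in>UNIV. (len (\<tau> l) * (?W (side (\<tau> l)) (mid (\<tau> l)))\<^sup>2 +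
       (1 - 1 / (real m)\<^sup>2) * ((w $ l)\<^sup>2 * len (\<tau> l) ^ 3 / 12)) / 4)"
  proof (intro sum.cong refl)
    fix l
    have "?W (side (\<tau> l)) (mid (sub_element m (\<tau> l) i)) = ?W (side (\<tau> l)) (mid (\<tau> l)) +
        w $ l * ((real i + 1 / 2) * len (\<tau> l) / real m - len (\<tau> l) / 2)" if "i < m" for i
    proof -
      have "mid (sub_element m (\<tau> l) i) \<in> {lo (\<tau> l)..hi (\<tau> l)}"
        using sub_element_bounds[OF mesh_lo_less_hi[OF assms(1)] that, of l]
        by (simp add: mid_def del: sub_element_sel)
      then show ?thesis
        by (simp only: primitive_affine[OF assms(1), of _ l] mid_sub_element)
    qed
    then show "(\<Sum>i<m. len (sub_element m (\<tau> l) i) *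
        (?W (side (sub_element m (\<tau> l) i)) (mid (sub_element m (\<tau> l) i)))\<^sup>2 / 4) =
        (len (\<tau> l) * (?W (side (\<tau> l)) (mid (\<tau> l)))\<^sup>2 +
         (1 - 1 / (real m)\<^sup>2) * ((w $ l)\<^sup>2 * len (\<tau> l) ^ 3 / 12)) / 4"
      unfolding sum_midpoint_squares[OF assms(4), symmetric] len_sub_element sum_divide_distrib
      by (intro sum.cong refl) simp
  qed
  finally show ?thesis
    by (simp add: sum_divide_distrib)
qed

theorem theorem3p1:
  fixes L T :: real and m :: nat
    and \<tau>H :: "'l::finite \<Rightarrow> element" and \<tau>h :: "'k::finite \<Rightarrow> element"
  assumes "L > 0" and "T = L"
    and "is_mesh T \<tau>H"
    and "is_uniform_refinement m \<tau>H \<tau>h"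
    and "m > 2"
  shows "positive_definite (schur_mat L T \<tau>H \<tau>h) \<and>
    (\<forall>w :: real ^ 'l.
      (schur_mat L T \<tau>H \<tau>h *v w) \<bullet> w \<ge>
        (1 / 2 - 1 / real m)\<^sup>2 * (dual_norm T (L2_inner_Sigma T (pc_fun \<tau>H w)))\<^sup>2)"
proof (intro conjI allI)
  have "T > 0" "m > 0"
    using assms by auto
  let ?W = "\<lambda>w l. primitive \<tau>H w (side (\<tau>H l)) (mid (\<tau>H l))"
  \<comment> \<open>The contributions of the midpoint value and of the slope to the squared norm of
    the primitive on one element.\<close>
  let ?\<alpha> = "\<lambda>w l. len (\<tau>H l) * (?W w l)\<^sup>2" and ?\<beta> = "\<lambda>w l. (w $ l)\<^sup>2 * len (\<tau>H l) ^ 3 / 12"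
  have len: "len (\<tau>H l) > 0" for l
    using mesh_lo_less_hi[OF assms(3)] by simp
  have nonneg: "0 \<le> ?\<alpha> w l" "0 \<le> ?\<beta> w l" for w l
    using len[of l] by simp_all
  have quad: "(schur_mat L T \<tau>H \<tau>h *v w) \<bullet> w =
      (\<Sum>l\<in>UNIV. ?\<alpha> w l + (1 - 1 / (real m)\<^sup>2) * ?\<beta> w l) / 4" for w
    using schur_mat_eq[OF assms(3,4) \<open>T > 0\<close> \<open>m > 0\<close>] assms(2) by simp
  have m: "0 < 1 / real m" "1 / real m < 1"
    using assms(5) by auto
  have factor: "(1 / real m)\<^sup>2 < 1"
    using m by (simp add: abs_square_less_1)

  show "positive_definite (schur_mat L T \<tau>H \<tau>h)"
    unfolding positive_definite_def
  proof (intro conjI allI impI)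
    show "transpose (schur_mat L T \<tau>H \<tau>h) = schur_mat L T \<tau>H \<tau>h"
      by (rule schur_mat_quadratic_form[OF assms(3,4)])
    fix w :: "real ^ 'l"
    assume "w \<noteq> 0"
    then obtain l where "w $ l \<noteq> 0"
      by (auto simp: vec_eq_iff)
    \<comment> \<open>A nonzero coefficient is a nonzero slope, whose contribution stays positive
      after the factor 1 - 1 / m^2.\<close>
    then have "0 < ?\<beta> w l"
      using len[of l] by simp
    have "0 < (\<Sum>l\<in>UNIV. ?\<alpha> w l + (1 - 1 / (real m)\<^sup>2) * ?\<beta> w l)"
    proof (rule sum_pos2)
      show "0 < ?\<alpha> w l + (1 - 1 / (real m)\<^sup>2) * ?\<beta> w l"
        using nonneg(1)[where w = w and l = l] \<open>0 < ?\<beta> w l\<close> factor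
        by (intro add_nonneg_pos mult_pos_pos) (auto simp: power_one_over)
      show "0 \<le> ?\<alpha> w l + (1 - 1 / (real m)\<^sup>2) * ?\<beta> w l" for l
        using nonneg[where w = w and l = l] factor len[of l]
        by (intro add_nonneg_nonneg mult_nonneg_nonneg) (auto simp: power_one_over)
    qed auto
    then show "0 < (schur_mat L T \<tau>H \<tau>h *v w) \<bullet> w"
      by (simp add: quad)
  qed

  fix w :: "real ^ 'l"
  let ?N = "L2_inner T (primitive \<tau>H w At0) (primitive \<tau>H w At0) +
      L2_inner T (primitive \<tau>H w AtL) (primitive \<tau>H w AtL)"
  have N: "?N = (\<Sum>l\<in>UNIV. ?\<alpha> w l + ?\<beta> w l)"
  proof -
    have UNIV: "UNIV = {l. side (\<tau>H l) = At0} \<union> {l. side (\<tau>H l) = AtL}"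
      using side.exhaust by auto
    have "(\<Sum>l\<in>UNIV. ?\<alpha> w l + ?\<beta> w l) =
        (\<Sum>l | side (\<tau>H l) = At0. ?\<alpha> w l + ?\<beta> w l) + (\<Sum>l | side (\<tau>H l) = AtL. ?\<alpha> w l + ?\<beta> w l)"
      by (subst UNIV, rule sum.union_disjoint) auto
    then show ?thesis
      by (simp add: L2_norm_primitive[OF assms(3)])
  qed
  have "(dual_norm T (L2_inner_Sigma T (pc_fun \<tau>H w)))\<^sup>2 \<le> (sqrt ?N)\<^sup>2"
    using abs_dual_norm_pc_fun_le[OF assms(3) \<open>T > 0\<close>] by (metis abs_ge_zero power2_abs power_mono)
  also have "(sqrt ?N)\<^sup>2 = ?N"
    by (simp add: L2_inner_nonneg)
  finally have "(1 / 2 - 1 / real m)\<^sup>2 * (dual_norm T (L2_inner_Sigma T (pc_fun \<tau>H w)))\<^sup>2 \<le>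
      (1 / 2 - 1 / real m)\<^sup>2 * ?N"
    by (rule mult_left_mono) simp
  also have "\<dots> \<le> (1 - (1 / real m)\<^sup>2) / 4 * ?N"
  proof (rule mult_right_mono)
    have "(1 / real m)\<^sup>2 \<le> 1 / real m * (1 / 2)"
      using m assms(5) unfolding power2_eq_square by (intro mult_left_mono) auto
    \<comment> \<open>The inequality amounts to 5 x^2 \<le> 4 x, with x = 1 / m.\<close>
    moreover have "(1 / 2 - x)\<^sup>2 \<le> (1 - x\<^sup>2) / 4" if "x\<^sup>2 \<le> x * (1 / 2)" "0 < x" for x :: real
    proof -
      have "(1 / 2 - x)\<^sup>2 = 1 / 4 - x + x\<^sup>2"
        by (simp add: power2_eq_square algebra_simps)
      then show ?thesis
        using that by simp
    qed
    ultimately show "(1 / 2 - 1 / real m)\<^sup>2 \<le> (1 - (1 / real m)\<^sup>2) / 4"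
      using m(1) by blast
  qed (simp add: L2_inner_nonneg)
  also have "\<dots> = (\<Sum>l\<in>UNIV. (1 - (1 / real m)\<^sup>2) * (?\<alpha> w l + ?\<beta> w l)) / 4"
    by (simp only: N sum_distrib_left[symmetric] times_divide_eq_left)
  also have "\<dots> \<le> (\<Sum>l\<in>UNIV. ?\<alpha> w l + (1 - 1 / (real m)\<^sup>2) * ?\<beta> w l) / 4"
  proof (intro divide_right_mono sum_mono)
    fix l
    \<comment> \<open>Lowering the factor 1 of the midpoint part lets both parts share 1 - 1 /
      m^2.\<close>
    have "(1 - (1 / real m)\<^sup>2) * ?\<alpha> w l \<le> 1 * ?\<alpha> w l"
      using nonneg by (intro mult_right_mono) auto
    then show "(1 - (1 / real m)\<^sup>2) * (?\<alpha> w l + ?\<beta> w l) \<le>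
        ?\<alpha> w l + (1 - 1 / (real m)\<^sup>2) * ?\<beta> w l"
      by (simp add: distrib_left power_one_over)
  qed simp
  finally show "(1 / 2 - 1 / real m)\<^sup>2 * (dual_norm T (L2_inner_Sigma T (pc_fun \<tau>H w)))\<^sup>2 \<le>
      (schur_mat L T \<tau>H \<tau>h *v w) \<bullet> w"
    by (simp only: quad)
qed

end
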